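(* Let $G$ be a connected metric graph with $\ell(G)$ leaves, cyclomatic number $\mathrm{cyc}(G)$, total length $\mathrm{len}(G)$ and radius $R=\mathrm{radius}(G)$. Then the equality $$\mathrm{len}(G) = \big(2\,\mathrm{cyc}(G) + \ell(G)\big)\cdot R$$ holds if and only if $G$ consists of a single non-leaf vertex $u$, together with $\ell(G)$ edges of length $R$ each joining $u$ to a distinct leaf, and $\mathrm{cyc}(G)$ loops of length $2R$ incident to $u$.
   Context: A metric graph is the compact metric space obtained from a finite collection of compact intervals (edges) of positive length by identifying their endpoints in groups (the vertices); equivalently, it is a finite edge-weighted multigraph (loops and parallel edges allowed) in which all points in the interior of each edge are included and each edge is locally isometric to an interval whose length is the edge weight. Metric graphs are assumed connected. Vertices of degree two may be inserted by splitting edges, or removed by merging edges, without changing the metric graph; in the description in the claim, $u$ may be such a vertex of degree two. The distance $d_G(x,y)$ is the minimum length of a path in $G$ from $x$ to $y$. The radius is $\mathrm{radius}(G)=\min_{x\in G}\max_{y\in G} d_G(x,y)$, over all points of $G$ (not only vertices). The length $\mathrm{len}(G)$ is the sum of the lengths of the edges. A leaf is a vertex of degree one, and $\ell(G)$ is the number of leaves. The cyclomatic number is $\mathrm{cyc}(G)=|E|-|V|+1$ for any combinatorial graph $(V,E)$ describing $G$. *)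

theory Defs
  imports "HOL-Analysis.Analysis"
begin

section \<open>Edge-weighted multigraphs\<close>

text \<open>
  Edges are undirected: \<open>tail e\<close> and \<open>head e\<close> only record which end of the interval
  \<open>[0, elen e]\<close> is glued to which vertex. Loops and parallel edges are allowed.
\<close>

record ('v, 'e) wgraph =
  verts :: "'v set"
  edges :: "'e set"
  tail  :: "'e \<Rightarrow> 'v"
  head  :: "'e \<Rightarrow> 'v"
  elen  :: "'e \<Rightarrow> real"

definition adjacency :: "('v, 'e) wgraph \<Rightarrow> ('v \<times> 'v) set" where
  "adjacency G = (\<Union>e\<in>edges G. {(tail G e, head G e), (head G e, tail G e)})"

locale connected_wgraph =
  fixes G :: "('v, 'e) wgraph"
  assumes finite_verts: "finite (verts G)"
    and finite_edges: "finite (edges G)"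
    and tail_in: "e \<in> edges G \<Longrightarrow> tail G e \<in> verts G"
    and head_in: "e \<in> edges G \<Longrightarrow> head G e \<in> verts G"
    and elen_pos: "e \<in> edges G \<Longrightarrow> 0 < elen G e"
    and verts_nonempty: "verts G \<noteq> {}"
    and connected: "\<lbrakk>u \<in> verts G; v \<in> verts G\<rbrakk> \<Longrightarrow> (u, v) \<in> (adjacency G)\<^sup>*"

text \<open>A loop contributes two to the degree.\<close>

definition degree :: "('v, 'e) wgraph \<Rightarrow> 'v \<Rightarrow> nat" where
  "degree G v = card {e \<in> edges G. tail G e = v} + card {e \<in> edges G. head G e = v}"

definition leaves :: "('v, 'e) wgraph \<Rightarrow> 'v set" where
  "leaves G = {v \<in> verts G. degree G v = 1}"

definition total_length :: "('v, 'e) wgraph \<Rightarrow> real" where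
  "total_length G = (\<Sum>e\<in>edges G. elen G e)"

definition cyc :: "('v, 'e) wgraph \<Rightarrow> int" where
  "cyc G = int (card (edges G)) - int (card (verts G)) + 1"


section \<open>The metric space described by a weighted multigraph\<close>

datatype ('v, 'e) point = Vertex 'v | Inner 'e real

text \<open>The point at position \<open>t \<in> [0, elen e]\<close> of the edge \<open>e\<close>, after the identification of
  the end points of the edges with vertices.\<close>

definition point_at :: "('v, 'e) wgraph \<Rightarrow> 'e \<Rightarrow> real \<Rightarrow> ('v, 'e) point" where
  "point_at G e t =
     (if t = 0 then Vertex (tail G e)
      else if t = elen G e then Vertex (head G e)
      else Inner e t)"

definition points :: "('v, 'e) wgraph \<Rightarrow> ('v, 'e) point set" where
  "points G = Vertex ` verts G \<union> {point_at G e t | e t. e \<in> edges G \<and> t \<in> {0..elen G e}}"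

text \<open>\<open>path_of_length G x y r\<close>: some path from \<open>x\<close> to \<open>y\<close> that is a finite concatenation of
  segments, each of them inside a single closed edge, has length \<open>r\<close>.\<close>

inductive path_of_length ::
  "('v, 'e) wgraph \<Rightarrow> ('v, 'e) point \<Rightarrow> ('v, 'e) point \<Rightarrow> real \<Rightarrow> bool" for G where
  trivial: "x \<in> points G \<Longrightarrow> path_of_length G x x 0"
| segment: "\<lbrakk>path_of_length G x (point_at G e s) r; e \<in> edges G;
             s \<in> {0..elen G e}; t \<in> {0..elen G e}\<rbrakk>
            \<Longrightarrow> path_of_length G x (point_at G e t) (r + \<bar>s - t\<bar>)"

text \<open>The infimum is attained. The value \<open>0\<close> outside of \<open>points G\<close> is needed because
  \<^locale>\<open>Metric_space\<close> demands non-negativity and symmetry on the whole type.\<close>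

definition graph_dist ::
  "('v, 'e) wgraph \<Rightarrow> ('v, 'e) point \<Rightarrow> ('v, 'e) point \<Rightarrow> real" where
  "graph_dist G x y =
     (if x \<in> points G \<and> y \<in> points G then Inf {r. path_of_length G x y r} else 0)"

definition realization :: "('v, 'e) wgraph \<Rightarrow> ('v, 'e) point metric" where
  "realization G = metric (points G, graph_dist G)"

definition isometric_spaces :: "'a metric \<Rightarrow> 'b metric \<Rightarrow> bool" where
  "isometric_spaces X Y \<longleftrightarrow>
     (\<exists>f. bij_betw f (mspace X) (mspace Y) \<and>
          (\<forall>x\<in>mspace X. \<forall>y\<in>mspace X. mdist Y (f x) (f y) = mdist X x y))"

text \<open>A metric graph is a metric space \<open>X\<close> that has some description \<open>G\<close> in this sense.
  Inserting or removing vertices of degree two changes \<open>G\<close> but not \<open>X\<close>.\<close>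

definition describes :: "('v, 'e) wgraph \<Rightarrow> 'a metric \<Rightarrow> bool" where
  "describes G X \<longleftrightarrow> connected_wgraph G \<and> isometric_spaces (realization G) X"

text \<open>On a metric graph, which is compact, the infimum and the supremum are attained.\<close>

definition radius :: "'a metric \<Rightarrow> real" where
  "radius X = (INF x\<in>mspace X. SUP y\<in>mspace X. mdist X x y)"


section \<open>Stars with loops\<close>

text \<open>A single non-leaf vertex \<open>u\<close>, \<open>n\<close> edges (the set \<open>A\<close>) of length \<open>R\<close> joining \<open>u\<close> to
  distinct leaves, and \<open>c\<close> loops (the set \<open>B\<close>) of length \<open>2 * R\<close> at \<open>u\<close>.\<close>

definition star_with_loops :: "('v, 'e) wgraph \<Rightarrow> nat \<Rightarrow> int \<Rightarrow> real \<Rightarrow> bool" where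
  "star_with_loops H n c R \<longleftrightarrow>
     (\<exists>u A B w.
        verts H - leaves H = {u} \<and>
        edges H = A \<union> B \<and> A \<inter> B = {} \<and>
        card A = n \<and> int (card B) = c \<and>
        bij_betw w A (leaves H) \<and>
        (\<forall>e\<in>A. {tail H e, head H e} = {u, w e} \<and> elen H e = R) \<and>
        (\<forall>e\<in>B. tail H e = u \<and> head H e = u \<and> elen H e = 2 * R))"


section \<open>The realization is a metric space\<close>

lemma point_at_in_points:
  "\<lbrakk>e \<in> edges G; t \<in> {0..elen G e}\<rbrakk> \<Longrightarrow> point_at G e t \<in> points G"
  by (auto simp: points_def)

lemma path_of_length_points:
  "path_of_length G x y r \<Longrightarrow> x \<in> points G \<and> y \<in> points G"
  by (induction rule: path_of_length.induct) (auto simp: point_at_in_points)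

lemma path_of_length_nonneg: "path_of_length G x y r \<Longrightarrow> 0 \<le> r"
  by (induction rule: path_of_length.induct) auto

lemma path_of_length_append:
  assumes "path_of_length G y z s" "path_of_length G x y r"
  shows "path_of_length G x z (r + s)"
  using assms
proof (induction arbitrary: r rule: path_of_length.induct)
  case (segment y e s r' t)
  show ?case
    using path_of_length.segment[OF segment.IH[OF segment.prems] segment.hyps(2-4)]
    by (simp add: add.assoc)
qed simp

lemma path_of_length_single:
  "\<lbrakk>e \<in> edges G; s \<in> {0..elen G e}; t \<in> {0..elen G e}\<rbrakk>
    \<Longrightarrow> path_of_length G (point_at G e s) (point_at G e t) \<bar>s - t\<bar>"
  using path_of_length.segment[OF path_of_length.trivial[OF point_at_in_points]]
  by fastforce

lemma path_of_length_sym: "path_of_length G x y r \<Longrightarrow> path_of_length G y x r"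
proof (induction rule: path_of_length.induct)
  case (segment x e s r t)
  show ?case
    using path_of_length_append[OF segment.IH path_of_length_single[OF segment.hyps(2,4,3)]]
    by (simp add: abs_minus_commute add.commute)
qed (rule path_of_length.trivial)

lemma graph_dist_le: "path_of_length G x y r \<Longrightarrow> graph_dist G x y \<le> r"
  using path_of_length_points[of G x y r]
  by (auto simp: graph_dist_def intro!: cInf_lower bdd_belowI[of _ 0] path_of_length_nonneg)

context connected_wgraph
begin

lemma path_between_vertices:
  assumes "u \<in> verts G" "v \<in> verts G"
  shows "\<exists>r. path_of_length G (Vertex u) (Vertex v) r"
  using connected[OF assms]
proof (induction rule: rtrancl_induct)
  case base
  then show ?case using assms path_of_length.trivial by (fastforce simp: points_def)
next
  case (step y z)
  then obtain e where e: "e \<in> edges G"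
    "(y = tail G e \<and> z = head G e) \<or> (y = head G e \<and> z = tail G e)"
    by (auto simp: adjacency_def)
  have pos: "elen G e > 0" using elen_pos e by auto
  have "path_of_length G (Vertex (tail G e)) (Vertex (head G e)) (elen G e)"
    using path_of_length_single[OF e(1), of 0 "elen G e"] pos by (simp add: point_at_def)
  then have "path_of_length G (Vertex y) (Vertex z) (elen G e)"
    using e(2) path_of_length_sym by blast
  then show ?case using step.IH path_of_length_append by blast
qed

lemma path_to_some_vertex:
  assumes "x \<in> points G" shows "\<exists>v\<in>verts G. \<exists>r. path_of_length G (Vertex v) x r"
  using assms unfolding points_def
proof
  assume "x \<in> Vertex ` verts G"
  then show ?thesis using assms path_of_length.trivial by blast
next
  assume "x \<in> {point_at G e t | e t. e \<in> edges G \<and> t \<in> {0..elen G e}}"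
  then obtain e t where e: "e \<in> edges G" "t \<in> {0..elen G e}" "x = point_at G e t" by blast
  have "path_of_length G (point_at G e 0) x \<bar>0 - t\<bar>"
    unfolding e(3) using e(2) by (intro path_of_length_single e(1)) auto
  then have "path_of_length G (Vertex (tail G e)) x \<bar>0 - t\<bar>"
    by (simp add: point_at_def)
  then show ?thesis using tail_in[OF e(1)] by blast
qed

lemma path_exists:
  assumes "x \<in> points G" "y \<in> points G" shows "\<exists>r. path_of_length G x y r"
  using path_to_some_vertex[OF assms(1)] path_to_some_vertex[OF assms(2)]
    path_between_vertices path_of_length_append path_of_length_sym by meson

lemma graph_dist_greatest:
  assumes "x \<in> points G" "y \<in> points G" "\<And>r. path_of_length G x y r \<Longrightarrow> a \<le> r"
  shows "a \<le> graph_dist G x y"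
  using path_exists[OF assms(1,2)] assms
  by (auto simp: graph_dist_def intro!: cInf_greatest)

lemma graph_dist_lipschitz:
  fixes f :: "('v, 'e) point \<Rightarrow> real"
  assumes lip: "\<And>e s t. \<lbrakk>e \<in> edges G; 0 \<le> s; s \<le> t; t \<le> elen G e\<rbrakk>
      \<Longrightarrow> \<bar>f (point_at G e s) - f (point_at G e t)\<bar> \<le> t - s"
    and "x \<in> points G" "y \<in> points G"
  shows "\<bar>f x - f y\<bar> \<le> graph_dist G x y"
proof (rule graph_dist_greatest)
  show "\<bar>f x - f y\<bar> \<le> r" if "path_of_length G x y r" for r
    using that
  proof (induction rule: path_of_length.induct)
    case (segment x e s r t)
    have "\<bar>f (point_at G e s) - f (point_at G e t)\<bar> \<le> \<bar>s - t\<bar>"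
      using lip[OF segment.hyps(2), of s t] lip[OF segment.hyps(2), of t s] segment.hyps
      by (cases "s \<le> t") auto
    then show ?case using segment.IH by linarith
  qed simp
qed fact+

lemma graph_dist_pos_Inner:
  assumes "x \<in> points G" "y \<in> points G" "x = Inner e t" "x \<noteq> y"
  shows "0 < graph_dist G x y"
proof -
  have e: "e \<in> edges G" "0 < t" "t < elen G e"
    using assms by (auto simp: points_def point_at_def split: if_splits)
  define d where "d = min t (elen G e - t)"
  define f where "f = (\<lambda>z :: ('v, 'e) point. case z of
    Inner e' t' \<Rightarrow> if e' = e then max 0 (d - \<bar>t - t'\<bar>) else 0 | Vertex v \<Rightarrow> 0)"
  have d: "0 < d" "d \<le> t" "d \<le> elen G e - t" using e by (auto simp: d_def)
  have f_at: "f (point_at G e' s) = (if e' = e then max 0 (d - \<bar>t - s\<bar>) else 0)"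
    if "0 \<le> s" "s \<le> elen G e'" for e' s
    using that d by (auto simp: f_def point_at_def)
  have "\<bar>f x - f y\<bar> \<le> graph_dist G x y"
  proof (rule graph_dist_lipschitz)
    fix e' s s' assume "e' \<in> edges G" "0 \<le> s" "s \<le> s'" "s' \<le> elen G e'"
    then show "\<bar>f (point_at G e' s) - f (point_at G e' s')\<bar> \<le> s' - s"
      by (auto simp: f_at)
  qed fact+
  moreover have "f x = d" using assms d by (simp add: f_def)
  moreover have "f y < d" using assms d by (auto simp: f_def split: point.splits)
  ultimately show ?thesis by linarith
qed

lemma graph_dist_pos_Vertex:
  assumes "x \<in> points G" "y \<in> points G" "x = Vertex u" "y = Vertex v" "x \<noteq> y"
  shows "0 < graph_dist G x y"
proof -
  define d where "d = Min (insert 1 (elen G ` edges G)) / 2"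
  define g where "g = (\<lambda>e t. max (if tail G e = u then max 0 (d - t) else 0)
                             (if head G e = u then max 0 (d - (elen G e - t)) else 0))"
  define f where "f = (\<lambda>z :: ('v, 'e) point. case z of
    Inner e t \<Rightarrow> g e t | Vertex w \<Rightarrow> (if w = u then d else 0))"
  have d0: "0 < d" using finite_edges elen_pos by (auto simp: d_def)
  have d1: "2 * d \<le> elen G e" if "e \<in> edges G" for e
    using finite_edges that by (auto simp: d_def)
  have f_at: "f (point_at G e s) = g e s" if "e \<in> edges G" for e s
    using d0 d1[OF that] elen_pos[OF that] by (auto simp: f_def point_at_def g_def)
  have "\<bar>f x - f y\<bar> \<le> graph_dist G x y"
  proof (rule graph_dist_lipschitz)
    fix e s t assume "e \<in> edges G" "0 \<le> s" "s \<le> t" "t \<le> elen G e"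
    then show "\<bar>f (point_at G e s) - f (point_at G e t)\<bar> \<le> t - s"
      by (auto simp: f_at g_def max_def)
  qed fact+
  moreover have "f x = d" "f y = 0" using assms by (auto simp: f_def)
  ultimately show ?thesis using d0 by linarith
qed

lemma graph_dist_commute: "graph_dist G x y = graph_dist G y x"
proof -
  have "path_of_length G x y = path_of_length G y x"
    using path_of_length_sym by blast
  then show ?thesis by (auto simp: graph_dist_def)
qed

lemma Metric_space_graph_dist: "Metric_space (points G) (graph_dist G)"
proof
  show nonneg: "0 \<le> graph_dist G x y" for x y
    using graph_dist_greatest path_of_length_nonneg by (metis graph_dist_def order_refl)
  show "graph_dist G x y = graph_dist G y x" for x y
    by (rule graph_dist_commute)
  show "graph_dist G x y = 0 \<longleftrightarrow> x = y" if "x \<in> points G" "y \<in> points G" for x y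
  proof
    assume "x = y"
    then show "graph_dist G x y = 0"
      using graph_dist_le[OF path_of_length.trivial[OF that(1)]] nonneg[of x x] by simp
  next
    assume "graph_dist G x y = 0"
    then show "x = y"
      using that graph_dist_pos_Inner graph_dist_pos_Vertex graph_dist_commute
      by (metis order_less_irrefl point.exhaust)
  qed
  show "graph_dist G x z \<le> graph_dist G x y + graph_dist G y z"
    if "x \<in> points G" "y \<in> points G" "z \<in> points G" for x y z
  proof -
    have "graph_dist G x z - r \<le> graph_dist G y z" if r: "path_of_length G x y r" for r
      using graph_dist_le[OF path_of_length_append[OF _ r]] \<open>y \<in> points G\<close> \<open>z \<in> points G\<close>
      by (intro graph_dist_greatest) (auto simp: algebra_simps)
    then have "graph_dist G x z - graph_dist G y z \<le> graph_dist G x y"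
      using that by (intro graph_dist_greatest) (auto simp: algebra_simps)
    then show ?thesis by simp
  qed
qed

lemma mspace_realization: "mspace (realization G) = points G"
  by (simp add: realization_def Metric_space.mspace_metric[OF Metric_space_graph_dist])

lemma mdist_realization: "mdist (realization G) = graph_dist G"
  by (simp add: realization_def Metric_space.mdist_metric[OF Metric_space_graph_dist])

end

end

theory Submission
  imports Defs
begin

text \<open>
  Let \<open>u\<close> be a centre, made into a vertex by subdividing an edge, and let \<open>f\<close> be the distance
  from \<open>u\<close>. Every vertex \<open>v \<noteq> u\<close> has a parent edge, along which a shortest path from \<open>u\<close> arrives;
  it has length \<open>2 f(v) - f(a) - f(b)\<close>, where \<open>a\<close> and \<open>b\<close> are its ends. The other \<open>cyc\<close> edges
  have length at most \<open>2 R - f(a) - f(b)\<close>, because their farthest point is at distance at most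
  \<open>R\<close>. Summing up, \<open>len \<le> 2 R cyc + (\<Sum>v\<noteq>u. f(v) (2 - deg v)) \<le> (2 cyc + \<ell>) R\<close>. In the case of
  equality, \<open>u\<close> is not a leaf, the other vertices are leaves at distance \<open>R\<close> or have degree 2,
  and loops at \<open>u\<close> have length \<open>2 R\<close>. In a description with the fewest edges among those that have
  \<open>u\<close> as a vertex, no other vertex has degree 2, so this description is the star.
  Conversely, the total length of a description is determined by the metric, as the asymptotic
  growth of \<open>\<epsilon>\<close>-separated sets, so it can be read off the star.
\<close>

section \<open>Isometries of realizations\<close>

context connected_wgraph
begin

section \<open>Points and distances in one realization\<close>

lemma points_eq:
  "points G = Vertex ` verts G \<union> {Inner e t | e t. e \<in> edges G \<and> 0 < t \<and> t < elen G e}"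
proof (intro equalityI subsetI)
  fix x assume "x \<in> points G"
  then show "x \<in> Vertex ` verts G \<union> {Inner e t | e t. e \<in> edges G \<and> 0 < t \<and> t < elen G e}"
    using tail_in head_in by (auto simp: points_def point_at_def)
next
  fix x assume "x \<in> Vertex ` verts G \<union> {Inner e t | e t. e \<in> edges G \<and> 0 < t \<and> t < elen G e}"
  then show "x \<in> points G"
  proof
    assume "x \<in> {Inner e t | e t. e \<in> edges G \<and> 0 < t \<and> t < elen G e}"
    then obtain e t where "x = Inner e t" "e \<in> edges G" "0 < t" "t < elen G e" by blast
    then have "x = point_at G e t" "e \<in> edges G" "t \<in> {0..elen G e}"
      by (auto simp: point_at_def)
    then show ?thesis using point_at_in_points by metis
  qed (simp add: points_def)
qed

lemma Vertex_in_points [simp]: "Vertex v \<in> points G \<longleftrightarrow> v \<in> verts G"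
  by (auto simp: points_eq)

lemma Inner_in_points [simp]: "Inner e t \<in> points G \<longleftrightarrow> e \<in> edges G \<and> 0 < t \<and> t < elen G e"
  by (auto simp: points_eq)

lemma points_cases:
  assumes "x \<in> points G"
  obtains v where "x = Vertex v" "v \<in> verts G"
    | e t where "x = Inner e t" "e \<in> edges G" "0 < t" "t < elen G e"
  using assms by (auto simp: points_eq)

lemma point_at_0 [simp]: "point_at G e 0 = Vertex (tail G e)"
  by (simp add: point_at_def)

lemma point_at_elen [simp]: "e \<in> edges G \<Longrightarrow> point_at G e (elen G e) = Vertex (head G e)"
  using elen_pos[of e] by (auto simp: point_at_def)

lemma point_at_Inner: "0 < t \<Longrightarrow> t < elen G e \<Longrightarrow> point_at G e t = Inner e t"
  by (simp add: point_at_def)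

lemmas dist_nonneg = Metric_space.nonneg[OF Metric_space_graph_dist]
lemmas dist_zero = Metric_space.zero[OF Metric_space_graph_dist]
lemmas dist_triangle = Metric_space.triangle[OF Metric_space_graph_dist]

lemma dist_point_at_le:
  assumes "e \<in> edges G" "0 \<le> s" "s \<le> elen G e" "0 \<le> t" "t \<le> elen G e"
  shows "graph_dist G (point_at G e s) (point_at G e t) \<le> \<bar>s - t\<bar>"
  using assms by (intro graph_dist_le path_of_length_single) auto

text \<open>The distance in \<open>H\<close> from the fixed point \<open>\<phi> x\<close> is
  1-Lipschitz along every edge of \<open>G\<close>, by the triangle inequality. Comparing its values
  at \<open>x\<close> and \<open>y\<close> gives the bound.\<close>

lemma dist_contraction:
  assumes H: "connected_wgraph H"
    and maps: "\<And>x. x \<in> points G \<Longrightarrow> \<phi> x \<in> points H"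
    and edge: "\<And>e s t. \<lbrakk>e \<in> edges G; 0 \<le> s; s \<le> t; t \<le> elen G e\<rbrakk>
      \<Longrightarrow> graph_dist H (\<phi> (point_at G e s)) (\<phi> (point_at G e t)) \<le> t - s"
    and x: "x \<in> points G" and y: "y \<in> points G"
  shows "graph_dist H (\<phi> x) (\<phi> y) \<le> graph_dist G x y"
proof -
  interpret H: connected_wgraph H by fact
  have "\<bar>graph_dist H (\<phi> x) (\<phi> x) - graph_dist H (\<phi> x) (\<phi> y)\<bar> \<le> graph_dist G x y"
  proof (rule graph_dist_lipschitz[OF _ x y])
    fix e s t assume e: "e \<in> edges G" "0 \<le> s" "s \<le> t" "t \<le> elen G e"
    define a b where "a = \<phi> (point_at G e s)" and "b = \<phi> (point_at G e t)"
    have ab: "a \<in> points H" "b \<in> points H"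
      using e maps point_at_in_points[of e G] by (auto simp: a_def b_def)
    have "graph_dist H (\<phi> x) a \<le> graph_dist H (\<phi> x) b + graph_dist H b a"
      "graph_dist H (\<phi> x) b \<le> graph_dist H (\<phi> x) a + graph_dist H a b"
      using H.dist_triangle maps[OF x] ab by blast+
    moreover have "graph_dist H a b \<le> t - s" using edge[OF e] by (simp add: a_def b_def)
    ultimately show "\<bar>graph_dist H (\<phi> x) (\<phi> (point_at G e s)) -
        graph_dist H (\<phi> x) (\<phi> (point_at G e t))\<bar> \<le> t - s"
      unfolding a_def[symmetric] b_def[symmetric] using H.graph_dist_commute[of a b] by linarith
  qed
  moreover have "graph_dist H (\<phi> x) (\<phi> x) = 0" using H.dist_zero maps[OF x] by blast
  ultimately show ?thesis by linarith
qed

end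

text \<open>Stated on \<open>points\<close> and \<open>graph_dist\<close>, so that the type
  \<open>metric\<close> enters only in the final theorem.\<close>

definition graph_isometry ::
  "('v, 'e) wgraph \<Rightarrow> ('w, 'f) wgraph \<Rightarrow> (('v, 'e) point \<Rightarrow> ('w, 'f) point) \<Rightarrow> bool" where
  "graph_isometry G H g \<longleftrightarrow> bij_betw g (points G) (points H) \<and>
     (\<forall>x\<in>points G. \<forall>y\<in>points G. graph_dist H (g x) (g y) = graph_dist G x y)"

lemma graph_isometry_comp:
  "graph_isometry G H g \<Longrightarrow> graph_isometry H K h \<Longrightarrow> graph_isometry G K (h \<circ> g)"
  unfolding graph_isometry_def using bij_betw_trans[of g "points G" "points H" h "points K"]
  by (auto simp: bij_betw_apply)

lemma graph_isometry_inv: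
  assumes "graph_isometry G H g"
  shows "graph_isometry H G (inv_into (points G) g)"
proof -
  have g: "bij_betw g (points G) (points H)" using assms by (simp add: graph_isometry_def)
  note h = bij_betw_inv_into[OF g]
  have "graph_dist G (inv_into (points G) g x) (inv_into (points G) g y) = graph_dist H x y"
    if "x \<in> points H" "y \<in> points H" for x y
  proof -
    have "graph_dist H (g (inv_into (points G) g x)) (g (inv_into (points G) g y)) =
        graph_dist G (inv_into (points G) g x) (inv_into (points G) g y)"
      using assms that bij_betw_apply[OF h] by (simp add: graph_isometry_def)
    then show ?thesis using that bij_betw_inv_into_right[OF g] by simp
  qed
  then show ?thesis using h by (simp add: graph_isometry_def)
qed

text \<open>Both \<open>\<phi>\<close> and its inverse contract along edges, hence everywhere. The
  condition \<open>edge'\<close> serves twice: it makes the inverse a contraction along the edges of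
  \<open>H\<close>, and with \<open>s = t\<close> it gives surjectivity onto the inner
  points.\<close>

lemma graph_isometryI:
  assumes G: "connected_wgraph G" and H: "connected_wgraph H"
    and inj: "inj_on \<phi> (points G)"
    and maps: "\<And>x. x \<in> points G \<Longrightarrow> \<phi> x \<in> points H"
    and verts: "\<And>w. w \<in> verts H \<Longrightarrow> Vertex w \<in> \<phi> ` points G"
    and edge: "\<And>e s t. \<lbrakk>e \<in> edges G; 0 \<le> s; s \<le> t; t \<le> elen G e\<rbrakk>
      \<Longrightarrow> graph_dist H (\<phi> (point_at G e s)) (\<phi> (point_at G e t)) \<le> t - s"
    and edge': "\<And>e s t. \<lbrakk>e \<in> edges H; 0 \<le> s; s \<le> t; t \<le> elen H e\<rbrakk>
      \<Longrightarrow> \<exists>x\<in>points G. \<exists>y\<in>points G. \<phi> x = point_at H e s \<and> \<phi> y = point_at H e t \<and>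
            graph_dist G x y \<le> t - s"
  shows "graph_isometry G H \<phi>"
proof -
  interpret G: connected_wgraph G by fact
  interpret H: connected_wgraph H by fact
  have "points H \<subseteq> \<phi> ` points G"
  proof
    fix y assume "y \<in> points H"
    then show "y \<in> \<phi> ` points G"
    proof (cases rule: H.points_cases)
      case (2 e t)
      then have "\<exists>x\<in>points G. \<phi> x = point_at H e t" using edge'[of e t t] by auto
      then show ?thesis using 2 by (auto simp: H.point_at_Inner intro: rev_image_eqI)
    qed (use verts in auto)
  qed
  then have bij: "bij_betw \<phi> (points G) (points H)"
    using inj maps by (auto simp: bij_betw_def)
  define \<psi> where "\<psi> = inv_into (points G) \<phi>"
  have \<psi>: "\<psi> y \<in> points G" if "y \<in> points H" for y
    using bij_betw_apply[OF bij_betw_inv_into[OF bij]] that by (simp add: \<psi>_def)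
  have \<psi>\<phi>: "\<psi> (\<phi> x) = x" if "x \<in> points G" for x
    using bij_betw_inv_into_left[OF bij that] by (simp add: \<psi>_def)
  have "graph_dist H (\<phi> x) (\<phi> y) = graph_dist G x y" if "x \<in> points G" "y \<in> points G" for x y
  proof (rule antisym)
    show "graph_dist H (\<phi> x) (\<phi> y) \<le> graph_dist G x y"
      using that by (intro G.dist_contraction H maps edge)
    have "graph_dist G (\<psi> (\<phi> x)) (\<psi> (\<phi> y)) \<le> graph_dist H (\<phi> x) (\<phi> y)"
    proof (intro H.dist_contraction G \<psi> maps that)
      fix e s t assume "e \<in> edges H" "0 \<le> s" "s \<le> t" "t \<le> elen H e"
      from edge'[OF this] show "graph_dist G (\<psi> (point_at H e s)) (\<psi> (point_at H e t)) \<le> t - s"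
        using \<psi>\<phi> by metis
    qed
    then show "graph_dist G x y \<le> graph_dist H (\<phi> x) (\<phi> y)" using \<psi>\<phi> that by simp
  qed
  then show ?thesis using bij by (simp add: graph_isometry_def)
qed

section \<open>The length is determined by the metric\<close>

text \<open>Pigeonhole: cut each edge into half-open pieces of length \<open>\<epsilon>\<close>. A
  separated set has at most one inner point in each piece and one point at each vertex.\<close>

lemma (in connected_wgraph) card_separated_le:
  assumes \<epsilon>: "0 < \<epsilon>" and S: "S \<subseteq> points G"
    and sep: "\<And>x y. \<lbrakk>x \<in> S; y \<in> S; x \<noteq> y\<rbrakk> \<Longrightarrow> \<epsilon> \<le> graph_dist G x y"
  shows "real (card S) \<le> total_length G / \<epsilon> + card (edges G) + card (verts G)"
proof -
  define h where "h = (\<lambda>x :: ('v, 'e) point.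
    case x of Vertex v \<Rightarrow> Inl v | Inner e t \<Rightarrow> Inr (e, \<lfloor>t / \<epsilon>\<rfloor>))"
  define J where "J = (SIGMA e:edges G. {0..\<lfloor>elen G e / \<epsilon>\<rfloor>})"
  have finJ: "finite J" using finite_edges by (simp add: J_def)
  have "inj_on h S"
  proof (rule inj_onI, rule ccontr)
    fix x y assume xy: "x \<in> S" "y \<in> S" "h x = h y" "x \<noteq> y"
    then obtain e s t where e: "x = Inner e s" "y = Inner e t" "\<lfloor>s / \<epsilon>\<rfloor> = \<lfloor>t / \<epsilon>\<rfloor>"
      by (auto simp: h_def split: point.splits)
    have st: "e \<in> edges G" "0 < s" "s < elen G e" "0 < t" "t < elen G e"
      using e xy S by auto
    have "\<bar>s / \<epsilon> - t / \<epsilon>\<bar> < 1" using e(3) by linarith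
    then have "\<bar>s - t\<bar> < \<epsilon>" using \<epsilon> by (simp add: diff_divide_distrib[symmetric] field_simps)
    moreover have "graph_dist G x y \<le> \<bar>s - t\<bar>"
      using dist_point_at_le[of e s t] st by (simp add: e point_at_Inner)
    ultimately show False using sep[OF xy(1,2,4)] by linarith
  qed
  moreover have "h ` S \<subseteq> Inl ` verts G \<union> Inr ` J"
  proof
    fix z assume "z \<in> h ` S"
    then obtain x where x: "x \<in> S" "z = h x" by blast
    have "x \<in> points G" using x S by blast
    then show "z \<in> Inl ` verts G \<union> Inr ` J"
    proof (cases rule: points_cases)
      case (2 e t)
      then have "(e, \<lfloor>t / \<epsilon>\<rfloor>) \<in> J"
        using \<epsilon> by (auto simp: J_def intro!: floor_mono divide_right_mono)
      then show ?thesis using 2 x by (simp add: h_def)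
    qed (simp add: h_def x)
  qed
  ultimately have "card S \<le> card (Inl ` verts G \<union> Inr ` J :: ('v + 'e \<times> int) set)"
    using finJ finite_verts by (intro card_inj_on_le) auto
  also have "\<dots> \<le> card (verts G) + card J"
    using card_Un_le[of "Inl ` verts G" "Inr ` J"] finJ finite_verts
    by (simp add: card_image inj_on_def)
  finally have "real (card S) \<le> card (verts G) + real (card J)" by linarith
  moreover have "real (card J) \<le> (\<Sum>e\<in>edges G. elen G e / \<epsilon> + 1)"
  proof -
    have "real (card J) = (\<Sum>e\<in>edges G. real (card {0..\<lfloor>elen G e / \<epsilon>\<rfloor>}))"
      using finite_edges by (simp add: J_def)
    also have "\<dots> \<le> (\<Sum>e\<in>edges G. elen G e / \<epsilon> + 1)"
    proof (rule sum_mono)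
      fix e assume "e \<in> edges G"
      then have "0 \<le> elen G e / \<epsilon>" using elen_pos[of e] \<epsilon> by simp
      then show "real (card {0..\<lfloor>elen G e / \<epsilon>\<rfloor>}) \<le> elen G e / \<epsilon> + 1"
        by simp
    qed
    finally show ?thesis .
  qed
  ultimately show ?thesis
    by (simp add: sum.distrib total_length_def sum_divide_distrib)
qed

text \<open>Take on each edge the multiples of \<open>\<epsilon>\<close> that stay at least
  \<open>\<epsilon>\<close> away from both ends, so that no route through a vertex brings two of
  them too close.\<close>

lemma (in connected_wgraph) separated_set:
  assumes \<epsilon>: "0 < \<epsilon>"
  obtains S where "S \<subseteq> points G"
    "\<And>x y. \<lbrakk>x \<in> S; y \<in> S; x \<noteq> y\<rbrakk> \<Longrightarrow> \<epsilon> \<le> graph_dist G x y"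
    "total_length G / \<epsilon> - 2 * card (edges G) \<le> real (card S)"
proof
  \<comment> \<open>The last multiple on an edge may lie too close to the head, so the range stops
    before it. Together with the rounding this loses at most 2 per edge.\<close>
  define J where "J = (SIGMA e:edges G. {1..\<lfloor>elen G e / \<epsilon>\<rfloor> - 1})"
  define pt where "pt = (\<lambda>(e :: 'e, k). Inner e (of_int k * \<epsilon>) :: ('v, 'e) point)"
  define S where "S = pt ` J"
  have inner: "e \<in> edges G \<and> \<epsilon> \<le> t \<and> t \<le> elen G e - \<epsilon> \<and> (\<exists>k::int. t = of_int k * \<epsilon>)"
    if et: "Inner e t \<in> S" for e t
  proof -
    obtain k where k: "e \<in> edges G" "1 \<le> k" "k < \<lfloor>elen G e / \<epsilon>\<rfloor>" "t = of_int k * \<epsilon>"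
      using et by (auto simp: S_def J_def pt_def)
    have "of_int k + 1 \<le> elen G e / \<epsilon>" using k(3) by linarith
    then show ?thesis using k \<epsilon> by (auto simp: field_simps)
  qed
  have S_inner: "\<exists>e t. x = Inner e t" if "x \<in> S" for x
    using that by (auto simp: S_def pt_def)
  show sub: "S \<subseteq> points G"
    using inner \<epsilon> S_inner by fastforce
  show "\<epsilon> \<le> graph_dist G x y" if xy: "x \<in> S" "y \<in> S" "x \<noteq> y" for x y
  proof -
    obtain e s where x: "x = Inner e s" using S_inner xy by blast
    obtain d t where y: "y = Inner d t" using S_inner xy by blast
    have s: "\<epsilon> \<le> s" "s \<le> elen G e - \<epsilon>" using inner x xy by auto
    \<comment> \<open>A tent of height \<open>\<epsilon>\<close> at \<open>x\<close>. By the bounds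
      on \<open>s\<close> it vanishes at both ends of the edge, so it extends by 0 to the whole
      graph, and it vanishes at the other points of \<open>S\<close>.\<close>
    define f where "f = (\<lambda>z :: ('v, 'e) point. case z of
      Inner e' t' \<Rightarrow> if e' = e then max 0 (\<epsilon> - \<bar>s - t'\<bar>) else 0 | Vertex v \<Rightarrow> 0)"
    have f_at: "f (point_at G e' r) = (if e' = e then max 0 (\<epsilon> - \<bar>s - r\<bar>) else 0)"
      if "0 \<le> r" "r \<le> elen G e'" for e' r
      using that s by (auto simp: f_def point_at_def)
    have "\<bar>f x - f y\<bar> \<le> graph_dist G x y"
    proof (rule graph_dist_lipschitz)
      fix e' r r' assume "e' \<in> edges G" "0 \<le> r" "r \<le> r'" "r' \<le> elen G e'"
      then show "\<bar>f (point_at G e' r) - f (point_at G e' r')\<bar> \<le> r' - r"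
        by (auto simp: f_at)
    qed (use sub xy in auto)
    moreover have "f x = \<epsilon>" using x \<epsilon> by (simp add: f_def)
    moreover have "f y = 0"
    proof (cases "d = e")
      case True
      obtain k l :: int where k: "s = of_int k * \<epsilon>" "t = of_int l * \<epsilon>"
        using inner x y xy by metis
      have "k \<noteq> l" using k True x y xy by auto
      then have "1 \<le> \<bar>real_of_int k - of_int l\<bar>" by linarith
      then have "1 * \<epsilon> \<le> \<bar>real_of_int k - of_int l\<bar> * \<epsilon>" using \<epsilon> by (intro mult_right_mono) auto
      also have "\<dots> = \<bar>s - t\<bar>" using \<epsilon> k by (simp add: left_diff_distrib[symmetric] abs_mult)
      finally show ?thesis using y by (simp add: f_def)
    qed (simp add: f_def y)
    ultimately show ?thesis using \<epsilon> by linarith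
  qed
  have "inj_on pt J" using \<epsilon> by (auto simp: inj_on_def pt_def)
  then have "real (card S) = real (card J)" by (simp add: S_def card_image)
  also have "\<dots> = (\<Sum>e\<in>edges G. real (card {1..\<lfloor>elen G e / \<epsilon>\<rfloor> - 1}))"
    using finite_edges by (simp add: J_def)
  also have "\<dots> \<ge> (\<Sum>e\<in>edges G. elen G e / \<epsilon> - 2)"
    by (rule sum_mono) (simp, linarith)
  finally show "total_length G / \<epsilon> - 2 * card (edges G) \<le> real (card S)"
    by (simp add: sum_subtractf total_length_def sum_divide_distrib)
qed

text \<open>The image of a large separated set of \<open>G\<close> is separated in \<open>H\<close>.
  The additive errors of both counts are bounded by \<open>C\<close>, which does not depend on
  \<open>\<epsilon>\<close>, so multiplying by \<open>\<epsilon>\<close> and letting it tend to 0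
  removes them.\<close>

lemma graph_isometry_total_length_le:
  assumes G: "connected_wgraph G" and H: "connected_wgraph H" and g: "graph_isometry G H g"
  shows "total_length G \<le> total_length H"
proof -
  interpret G: connected_wgraph G by fact
  interpret H: connected_wgraph H by fact
  define C where "C = real (2 * card (edges G) + card (edges H) + card (verts H))"
  have bound: "total_length G \<le> total_length H + C * \<epsilon>" if \<epsilon>: "0 < \<epsilon>" for \<epsilon>
  proof -
    obtain S where S: "S \<subseteq> points G"
      "\<And>x y. \<lbrakk>x \<in> S; y \<in> S; x \<noteq> y\<rbrakk> \<Longrightarrow> \<epsilon> \<le> graph_dist G x y"
      "total_length G / \<epsilon> - 2 * card (edges G) \<le> real (card S)"
      using G.separated_set[OF \<epsilon>] by blast
    have bij: "bij_betw g (points G) (points H)" using g by (simp add: graph_isometry_def)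
    have inj: "inj_on g S" using bij S(1) by (meson bij_betw_def inj_on_subset)
    have "real (card (g ` S)) \<le> total_length H / \<epsilon> + card (edges H) + card (verts H)"
    proof (rule H.card_separated_le[OF \<epsilon>])
      show "g ` S \<subseteq> points H" using bij S(1) bij_betw_apply by fastforce
      fix x y assume "x \<in> g ` S" "y \<in> g ` S" "x \<noteq> y"
      then obtain a b where ab: "a \<in> S" "b \<in> S" "x = g a" "y = g b" "a \<noteq> b" by blast
      then have "graph_dist H x y = graph_dist G a b"
        using g S(1) by (auto simp: graph_isometry_def)
      then show "\<epsilon> \<le> graph_dist H x y" using S(2) ab by simp
    qed
    then have "total_length G / \<epsilon> \<le> total_length H / \<epsilon> + C"
      using S(3) inj by (simp add: card_image C_def)
    then show ?thesis using \<epsilon> by (simp add: field_simps)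
  qed
  have "C \<ge> 0" by (simp add: C_def)
  show ?thesis
  proof (rule field_le_epsilon)
    fix \<delta> :: real assume "0 < \<delta>"
    then have "total_length G \<le> total_length H + C * (\<delta> / (C + 1))"
      using \<open>C \<ge> 0\<close> by (intro bound) auto
    also have "C * (\<delta> / (C + 1)) \<le> \<delta>"
      using \<open>C \<ge> 0\<close> \<open>0 < \<delta>\<close> by (simp add: field_simps)
    finally show "total_length G \<le> total_length H + \<delta>" by simp
  qed
qed

lemma graph_isometry_total_length:
  assumes "connected_wgraph G" "connected_wgraph H" "graph_isometry G H g"
  shows "total_length G = total_length H"
  using graph_isometry_total_length_le[OF assms]
    graph_isometry_total_length_le[OF assms(2,1) graph_isometry_inv[OF assms(3)]] by simp

section \<open>Relabelling and reorienting the edges\<close>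

text \<open>The number of ends of \<open>e\<close> at \<open>v\<close>. A loop at \<open>v\<close>
  counts 2, so the value 1 singles out the non-loop edges at \<open>v\<close>.\<close>

definition incidences :: "('v, 'e) wgraph \<Rightarrow> 'v \<Rightarrow> 'e \<Rightarrow> nat" where
  "incidences G v e = of_bool (tail G e = v) + of_bool (head G e = v)"

lemma degree_eq_sum:
  assumes "finite (edges G)"
  shows "degree G v = (\<Sum>e\<in>edges G. incidences G v e)"
proof -
  have "edges G \<inter> {e. P e} = {e \<in> edges G. P e}" for P by blast
  then show ?thesis
    using assms by (simp add: degree_def incidences_def sum.distrib sum_of_bool_eq)
qed

text \<open>Serves two purposes: renaming vertices and edges by natural numbers, and reversing
  single edges before a merge.\<close>

lemma relabel:
  assumes G: "connected_wgraph G"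
    and \<alpha>: "bij_betw \<alpha> (verts G) (verts H)" and \<beta>: "bij_betw \<beta> (edges G) (edges H)"
    and elen: "\<And>e. e \<in> edges G \<Longrightarrow> elen H (\<beta> e) = elen G e"
    and ends: "\<And>e. e \<in> edges G \<Longrightarrow>
      (tail H (\<beta> e) = \<alpha> (tail G e) \<and> head H (\<beta> e) = \<alpha> (head G e)) \<or>
      (tail H (\<beta> e) = \<alpha> (head G e) \<and> head H (\<beta> e) = \<alpha> (tail G e))"
  shows "connected_wgraph H"
    and "\<exists>g. graph_isometry G H g \<and> (\<forall>v\<in>verts G. g (Vertex v) = Vertex (\<alpha> v))"
    and "card (leaves H) = card (leaves G)" and "cyc H = cyc G"
proof -
  interpret G: connected_wgraph G by fact
  have \<alpha>_in: "\<alpha> v \<in> verts H" if "v \<in> verts G" for v using \<alpha> that by (rule bij_betw_apply)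
  have \<beta>_in: "\<beta> e \<in> edges H" if "e \<in> edges G" for e using \<beta> that by (rule bij_betw_apply)
  have \<alpha>_inj: "\<alpha> v = \<alpha> w \<longleftrightarrow> v = w" if "v \<in> verts G" "w \<in> verts G" for v w
    using \<alpha> that by (auto simp: bij_betw_def inj_on_def)
  have \<beta>_inj: "\<beta> e = \<beta> d \<longleftrightarrow> e = d" if "e \<in> edges G" "d \<in> edges G" for e d
    using \<beta> that by (auto simp: bij_betw_def inj_on_def)
  have vertsH: "verts H = \<alpha> ` verts G" and edgesH: "edges H = \<beta> ` edges G"
    using \<alpha> \<beta> by (auto simp: bij_betw_def)
  have reach: "(\<alpha> a, \<alpha> b) \<in> (adjacency H)\<^sup>*" if "(a, b) \<in> (adjacency G)\<^sup>*" for a b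
    using that
  proof (induction rule: rtrancl_induct)
    case (step b c)
    then obtain e where e: "e \<in> edges G"
      "(b, c) = (tail G e, head G e) \<or> (b, c) = (head G e, tail G e)"
      by (auto simp: adjacency_def)
    then have "(\<alpha> b, \<alpha> c) \<in> adjacency H"
      using ends[OF e(1)] \<beta>_in[OF e(1)] unfolding adjacency_def by (fastforce intro: bexI[of _ "\<beta> e"])
    then show ?case using step.IH by simp
  qed simp
  show H: "connected_wgraph H"
  proof
    show "finite (verts H)" "finite (edges H)" "verts H \<noteq> {}"
      using G.finite_verts G.finite_edges G.verts_nonempty by (auto simp: vertsH edgesH)
    fix e assume "e \<in> edges H"
    then obtain d where d: "d \<in> edges G" "e = \<beta> d" by (auto simp: edgesH)
    show "tail H e \<in> verts H" "head H e \<in> verts H" "0 < elen H e"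
      using ends[OF d(1)] elen[OF d(1)] G.elen_pos[OF d(1)] G.tail_in[OF d(1)] G.head_in[OF d(1)]
        \<alpha>_in d(2) by auto
  next
    fix u v assume "u \<in> verts H" "v \<in> verts H"
    then show "(u, v) \<in> (adjacency H)\<^sup>*"
      using reach G.connected by (auto simp: vertsH)
  qed
  interpret H: connected_wgraph H by fact
  \<comment> \<open>Edges that are not \<open>kept\<close> are traversed backwards, which replaces
    \<open>t\<close> by \<open>elen G e - t\<close>. For a loop both alternatives of
    \<open>ends\<close> hold, and it counts as kept.\<close>
  define kept where "kept = (\<lambda>e. tail H (\<beta> e) = \<alpha> (tail G e) \<and> head H (\<beta> e) = \<alpha> (head G e))"
  define \<phi> where "\<phi> = (\<lambda>x :: ('a, 'b) point. case x of Vertex v \<Rightarrow> Vertex (\<alpha> v) |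
    Inner e t \<Rightarrow> Inner (\<beta> e) (if kept e then t else elen G e - t))"
  have \<phi>_at: "\<phi> (point_at G e t) = point_at H (\<beta> e) (if kept e then t else elen G e - t)"
    if "e \<in> edges G" "0 \<le> t" "t \<le> elen G e" for e t
    using that ends[of e] elen[of e] G.elen_pos[of e] by (auto simp: \<phi>_def point_at_def kept_def)
  have "graph_isometry G H \<phi>"
  proof (rule graph_isometryI[OF G H])
    show "inj_on \<phi> (points G)"
      by (rule inj_onI) (auto simp: \<phi>_def \<alpha>_inj \<beta>_inj split: point.splits if_splits)
    show "\<phi> x \<in> points H" if "x \<in> points G" for x
      using that by (cases rule: G.points_cases) (auto simp: \<phi>_def \<alpha>_in \<beta>_in elen)
    show "Vertex w \<in> \<phi> ` points G" if "w \<in> verts H" for w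
      using that by (auto simp: vertsH \<phi>_def intro!: image_eqI[where x = "Vertex _"])
    fix e s t
    show "graph_dist H (\<phi> (point_at G e s)) (\<phi> (point_at G e t)) \<le> t - s"
      if "e \<in> edges G" "0 \<le> s" "s \<le> t" "t \<le> elen G e"
      using that H.dist_point_at_le[OF \<beta>_in[OF that(1)], of s t]
        H.dist_point_at_le[OF \<beta>_in[OF that(1)], of "elen G e - s" "elen G e - t"]
      by (auto simp: \<phi>_at elen)
  next
    fix e s t assume e: "e \<in> edges H" "0 \<le> s" "s \<le> t" "t \<le> elen H e"
    then obtain d where d: "d \<in> edges G" "e = \<beta> d" by (auto simp: edgesH)
    define \<tau> where "\<tau> = (\<lambda>r. if kept d then r else elen G d - r)"
    have \<tau>: "0 \<le> \<tau> r" "\<tau> r \<le> elen G d" "\<phi> (point_at G d (\<tau> r)) = point_at H e r"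
      if "0 \<le> r" "r \<le> elen H e" for r
      using that d elen[of d] by (auto simp: \<tau>_def \<phi>_at)
    have "graph_dist G (point_at G d (\<tau> s)) (point_at G d (\<tau> t)) \<le> \<bar>\<tau> s - \<tau> t\<bar>"
      using e \<tau> by (intro G.dist_point_at_le d) auto
    also have "\<dots> = t - s" using e by (auto simp: \<tau>_def)
    finally show "\<exists>x\<in>points G. \<exists>y\<in>points G. \<phi> x = point_at H e s \<and> \<phi> y = point_at H e t \<and>
        graph_dist G x y \<le> t - s"
      using \<tau> e d point_at_in_points[OF d(1)]
      by (intro bexI[of _ "point_at G d (\<tau> s)"] bexI[of _ "point_at G d (\<tau> t)"]) auto
  qed
  then show "\<exists>g. graph_isometry G H g \<and> (\<forall>v\<in>verts G. g (Vertex v) = Vertex (\<alpha> v))"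
    by (intro exI[of _ \<phi>]) (simp add: \<phi>_def)
  have "incidences H (\<alpha> v) (\<beta> e) = incidences G v e" if "v \<in> verts G" "e \<in> edges G" for v e
    using ends[OF that(2)] G.tail_in[OF that(2)] G.head_in[OF that(2)] that(1)
    by (auto simp: incidences_def \<alpha>_inj)
  then have "degree H (\<alpha> v) = degree G v" if "v \<in> verts G" for v
    using that sum.reindex_bij_betw[OF \<beta>, of "incidences H (\<alpha> v)"]
    by (simp add: degree_eq_sum G.finite_edges H.finite_edges)
  then have "leaves H = \<alpha> ` leaves G" by (auto simp: leaves_def vertsH)
  moreover have "inj_on \<alpha> (leaves G)" by (auto simp: inj_on_def \<alpha>_inj leaves_def)
  ultimately show "card (leaves H) = card (leaves G)" by (simp add: card_image)
  show "cyc H = cyc G"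
    using bij_betw_same_card[OF \<alpha>] bij_betw_same_card[OF \<beta>] by (simp add: cyc_def)
qed

section \<open>Subdividing an edge\<close>

text \<open>The name \<open>e\<close> is reused for the initial segment of length \<open>r\<close>;
  \<open>e'\<close> is the rest, from the new vertex \<open>w\<close> to the old head.\<close>

definition subdivide ::
  "('v, 'e) wgraph \<Rightarrow> 'e \<Rightarrow> real \<Rightarrow> 'v \<Rightarrow> 'e \<Rightarrow> ('v, 'e) wgraph" where
  "subdivide G e r w e' = \<lparr>verts = insert w (verts G), edges = insert e' (edges G),
     tail = (tail G)(e' := w), head = (head G)(e := w, e' := head G e),
     elen = (elen G)(e := r, e' := elen G e - r)\<rparr>"

locale subdivision = connected_wgraph G for G :: "('v, 'e) wgraph" +
  fixes e :: 'e and r :: real and w :: 'v and e' :: 'e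
  assumes e: "e \<in> edges G" and r: "0 < r" "r < elen G e"
    and w: "w \<notin> verts G" and e': "e' \<notin> edges G"
begin

abbreviation "H \<equiv> subdivide G e r w e'"

lemma e_neq: "e \<noteq> e'" using e e' by blast

lemma subdivide_simps:
  "verts H = insert w (verts G)" "edges H = insert e' (edges G)"
  "tail H d = (if d = e' then w else tail G d)"
  "head H d = (if d = e then w else if d = e' then head G e else head G d)"
  "elen H d = (if d = e then r else if d = e' then elen G e - r else elen G d)"
  using e_neq by (auto simp: subdivide_def)

lemma connected_subdivide: "connected_wgraph H"
proof
  have step: "(a, b) \<in> (adjacency H)\<^sup>*" if ab: "(a, b) \<in> adjacency G" for a b
  proof -
    obtain d where d: "d \<in> edges G" "(a, b) = (tail G d, head G d) \<or> (a, b) = (head G d, tail G d)"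
      using ab by (auto simp: adjacency_def)
    show ?thesis
    proof (cases "d = e")
      \<comment> \<open>A step along the subdivided edge becomes two steps through
        \<open>w\<close>.\<close>
      case True
      have "(tail G e, w) \<in> adjacency H" "(w, tail G e) \<in> adjacency H"
        using e e_neq by (auto simp: adjacency_def subdivide_simps intro!: bexI[of _ e])
      moreover have "(head G e, w) \<in> adjacency H" "(w, head G e) \<in> adjacency H"
        using e e_neq by (auto simp: adjacency_def subdivide_simps)
      ultimately show ?thesis using d True by (auto intro: converse_rtrancl_into_rtrancl)
    next
      case False
      then have "(a, b) \<in> adjacency H"
        using d e' by (force simp: adjacency_def subdivide_simps)
      then show ?thesis by blast
    qed
  qed
  have reach: "(a, b) \<in> (adjacency H)\<^sup>*" if "a \<in> verts G" "b \<in> verts G" for a b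
    using connected[OF that] by (induction rule: rtrancl_induct) (auto intro: rtrancl_trans step)
  have sym: "(adjacency H)\<inverse> = adjacency H" by (auto simp: adjacency_def)
  have "(tail G e, w) \<in> adjacency H"
    using e e_neq by (auto simp: adjacency_def subdivide_simps intro!: bexI[of _ e])
  then have to_w: "(a, w) \<in> (adjacency H)\<^sup>*" if "a \<in> verts G" for a
    using reach[OF that tail_in[OF e]] by simp
  then have from_w: "(w, a) \<in> (adjacency H)\<^sup>*" if "a \<in> verts G" for a
    using that rtrancl_converseI[of a w "adjacency H"] by (simp add: sym)
  show "(a, b) \<in> (adjacency H)\<^sup>*" if "a \<in> verts H" "b \<in> verts H" for a b
    using that reach to_w from_w by (auto simp: subdivide_simps)
qed (use finite_verts finite_edges tail_in head_in elen_pos r e e' in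
    \<open>auto simp: subdivide_simps split: if_splits\<close>)

lemma subdivide_isometry:
  "\<exists>g. graph_isometry G H g \<and> (\<forall>v\<in>verts G. g (Vertex v) = Vertex v) \<and> g (Inner e r) = Vertex w"
proof -
  interpret H: connected_wgraph H by (rule connected_subdivide)
  define \<phi> where "\<phi> = (\<lambda>x :: ('v, 'e) point. case x of Vertex v \<Rightarrow> Vertex v |
    Inner d t \<Rightarrow> if d \<noteq> e then Inner d t else if t < r then Inner e t
      else if t = r then Vertex w else Inner e' (t - r))"
  have at1: "\<phi> (point_at G d t) = point_at H d t" if "d \<in> edges G" "d \<noteq> e" for d t
    using that e' by (auto simp: \<phi>_def point_at_def subdivide_simps)
  have at2: "\<phi> (point_at G e t) = point_at H e t" if "0 \<le> t" "t \<le> r" for t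
    using that r e_neq by (auto simp: \<phi>_def point_at_def subdivide_simps)
  have at3: "\<phi> (point_at G e t) = point_at H e' (t - r)" if "r \<le> t" "t \<le> elen G e" for t
    using that r e_neq by (auto simp: \<phi>_def point_at_def subdivide_simps)
  have eH: "e \<in> edges H" "e' \<in> edges H" using e by (auto simp: subdivide_simps)
  have maps: "\<phi> x \<in> points H" if "x \<in> points G" for x
    using that
  proof (cases rule: points_cases)
    case (2 d t)
    then show ?thesis using r e' e by (auto simp: \<phi>_def subdivide_simps)
  qed (auto simp: \<phi>_def subdivide_simps)
  have le1: "graph_dist H (\<phi> (point_at G e s)) (\<phi> (point_at G e t)) \<le> t - s"
    if "0 \<le> s" "s \<le> t" "t \<le> r" for s t
    using that r e_neq H.dist_point_at_le[OF eH(1), of s t] by (simp add: at2 subdivide_simps)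
  have le2: "graph_dist H (\<phi> (point_at G e s)) (\<phi> (point_at G e t)) \<le> t - s"
    if "r \<le> s" "s \<le> t" "t \<le> elen G e" for s t
    using that r e_neq H.dist_point_at_le[OF eH(2), of "s - r" "t - r"]
    by (simp add: at3 subdivide_simps)
  have "graph_isometry G H \<phi>"
  proof (rule graph_isometryI[OF connected_wgraph_axioms connected_subdivide])
    show "inj_on \<phi> (points G)"
      using w e' r by (intro inj_onI) (auto simp: \<phi>_def split: point.splits if_splits)
    show "\<phi> x \<in> points H" if "x \<in> points G" for x using that by (rule maps)
    show "Vertex v \<in> \<phi> ` points G" if "v \<in> verts H" for v
    proof (cases "v = w")
      case True
      then show ?thesis using r e by (intro image_eqI[of _ _ "Inner e r"]) (auto simp: \<phi>_def)
    next
      case False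
      then show ?thesis using that
        by (intro image_eqI[of _ _ "Vertex v"]) (auto simp: \<phi>_def subdivide_simps)
    qed
    fix d s t
    show "graph_dist H (\<phi> (point_at G d s)) (\<phi> (point_at G d t)) \<le> t - s"
      if d: "d \<in> edges G" and st: "0 \<le> s" "s \<le> t" "t \<le> elen G d"
    proof (cases "d = e")
      case False
      have "d \<in> edges H" "elen H d = elen G d" using d False e' by (auto simp: subdivide_simps)
      then show ?thesis using st False d H.dist_point_at_le[of d s t] by (simp add: at1)
    next
      case True
      consider "t \<le> r" | "r \<le> s" | "s \<le> r" "r \<le> t" by linarith
      then show ?thesis
      proof cases
        \<comment> \<open>A segment that contains the cut point \<open>r\<close> is split
          there.\<close>
        case 3
        have "graph_dist H (\<phi> (point_at G e s)) (\<phi> (point_at G e t)) \<le>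
            graph_dist H (\<phi> (point_at G e s)) (\<phi> (point_at G e r)) +
            graph_dist H (\<phi> (point_at G e r)) (\<phi> (point_at G e t))"
          using st r True e 3 by (intro H.dist_triangle maps point_at_in_points) auto
        then show ?thesis using le1[of s r] le2[of r t] st True 3 by simp
      qed (use le1 le2 st True in auto)
    qed
  next
    fix d s t assume d: "d \<in> edges H" and st: "0 \<le> s" "s \<le> t" "t \<le> elen H d"
    \<comment> \<open>Every edge of \<open>H\<close> is a stretch of some edge of \<open>G\<close>
      starting at an offset \<open>k\<close>: \<open>r\<close> for \<open>e'\<close>, and 0 for all
      others.\<close>
    have "\<exists>d' k. d' \<in> edges G \<and> 0 \<le> k \<and> k + elen H d \<le> elen G d' \<and>
        (\<forall>q. 0 \<le> q \<and> q \<le> elen H d \<longrightarrow> \<phi> (point_at G d' (k + q)) = point_at H d q)"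
    proof (cases "d = e'")
      case True
      then show ?thesis using e r e_neq at3
        by (intro exI[of _ e] exI[of _ r]) (auto simp: subdivide_simps)
    next
      case False
      then show ?thesis using d r e at1 at2
        by (intro exI[of _ d] exI[of _ 0]) (cases "d = e"; auto simp: subdivide_simps)
    qed
    then obtain d' k where k: "d' \<in> edges G" "0 \<le> k" "k + elen H d \<le> elen G d'"
      "\<And>q. 0 \<le> q \<Longrightarrow> q \<le> elen H d \<Longrightarrow> \<phi> (point_at G d' (k + q)) = point_at H d q" by blast
    have "graph_dist G (point_at G d' (k + s)) (point_at G d' (k + t)) \<le> \<bar>(k + s) - (k + t)\<bar>"
      using k st by (intro dist_point_at_le) auto
    then show "\<exists>x\<in>points G. \<exists>y\<in>points G. \<phi> x = point_at H d s \<and> \<phi> y = point_at H d t \<and>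
        graph_dist G x y \<le> t - s"
      using k st point_at_in_points[OF k(1)]
      by (intro bexI[of _ "point_at G d' (k + s)"] bexI[of _ "point_at G d' (k + t)"]) auto
  qed
  then show ?thesis by (intro exI[of _ \<phi>]) (simp add: \<phi>_def)
qed

lemma subdivide_degree:
  assumes "v \<in> verts G" shows "degree H v = degree G v"
proof -
  interpret H: connected_wgraph H by (rule connected_subdivide)
  have "w \<noteq> v" using w assms by blast
  have "degree H v = incidences H v e' + incidences H v e + (\<Sum>d\<in>edges G - {e}. incidences H v d)"
    using e' e finite_edges
    by (simp add: degree_eq_sum H.finite_edges subdivide_simps(2) sum.remove[of "edges G" e])
  also have "(\<Sum>d\<in>edges G - {e}. incidences H v d) = (\<Sum>d\<in>edges G - {e}. incidences G v d)"
    using e' by (intro sum.cong) (auto simp: incidences_def subdivide_simps)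
  also have "incidences H v e' + incidences H v e = incidences G v e"
    using e_neq \<open>w \<noteq> v\<close> by (simp add: incidences_def subdivide_simps)
  finally show ?thesis
    using e finite_edges by (simp add: degree_eq_sum sum.remove[of "edges G" e])
qed

lemma subdivide_degree_new: "degree H w = 2"
proof -
  interpret H: connected_wgraph H by (rule connected_subdivide)
  have "degree H w = incidences H w e' + incidences H w e + (\<Sum>d\<in>edges G - {e}. incidences H w d)"
    using e' e finite_edges
    by (simp add: degree_eq_sum H.finite_edges subdivide_simps(2) sum.remove[of "edges G" e])
  moreover have "(\<Sum>d\<in>edges G - {e}. incidences H w d) = 0"
    using e' w tail_in head_in
    by (intro sum.neutral) (auto simp: incidences_def subdivide_simps)
  moreover have "incidences H w e' = 1" "incidences H w e = 1"
    using e_neq w e tail_in head_in by (auto simp: incidences_def subdivide_simps)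
  ultimately show ?thesis by simp
qed

lemma subdivide_leaves: "leaves H = leaves G"
  using subdivide_degree subdivide_degree_new w by (auto simp: leaves_def subdivide_simps)

lemma subdivide_cyc: "cyc H = cyc G"
  using e' w finite_edges finite_verts by (simp add: cyc_def subdivide_simps)

end

section \<open>Merging the two edges at a vertex of degree two\<close>

text \<open>In \<open>K\<close> the edge \<open>e\<close> is prolonged by \<open>e'\<close>.
  Subdividing \<open>K\<close> at the old length of \<open>e\<close>, with \<open>v\<close> and
  \<open>e'\<close> as the new names, gives back exactly \<open>G\<close>, so everything follows
  from the facts on subdivisions.\<close>

lemma merge_oriented:
  fixes G :: "('v, 'e) wgraph"
  assumes G: "connected_wgraph G" and e: "e \<in> edges G" and e': "e' \<in> edges G" and neq: "e \<noteq> e'"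
    and v: "head G e = v" "tail G e' = v" "tail G e \<noteq> v" "head G e' \<noteq> v"
    and others: "\<And>d. \<lbrakk>d \<in> edges G; d \<noteq> e; d \<noteq> e'\<rbrakk> \<Longrightarrow> tail G d \<noteq> v \<and> head G d \<noteq> v"
  obtains K :: "('v, 'e) wgraph" and g where "connected_wgraph K" "graph_isometry G K g"
    "\<forall>x\<in>verts G - {v}. x \<in> verts K \<and> g (Vertex x) = Vertex x"
    "leaves K = leaves G" "cyc K = cyc G" "card (edges K) < card (edges G)"
proof -
  interpret G: connected_wgraph G by fact
  define K where "K = G\<lparr>verts := verts G - {v}, edges := edges G - {e'},
    head := (head G)(e := head G e'), elen := (elen G)(e := elen G e + elen G e')\<rparr>"
  have K_simps: "verts K = verts G - {v}" "edges K = edges G - {e'}" "tail K = tail G"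
    "head K = (head G)(e := head G e')" "elen K = (elen G)(e := elen G e + elen G e')"
    by (simp_all add: K_def)
  \<comment> \<open>Collapsing \<open>v\<close> to the tail of \<open>e\<close> turns walks in
    \<open>G\<close> into walks in \<open>K\<close>.\<close>
  define \<pi> where "\<pi> = (\<lambda>a. if a = v then tail G e else a)"
  have step: "(\<pi> a, \<pi> b) \<in> (adjacency K)\<^sup>*" if ab: "(a, b) \<in> adjacency G" for a b
  proof -
    obtain d where d: "d \<in> edges G" "(a, b) = (tail G d, head G d) \<or> (a, b) = (head G d, tail G d)"
      using ab by (auto simp: adjacency_def)
    consider "d = e" | "d = e'" | "d \<noteq> e" "d \<noteq> e'" by blast
    then show ?thesis
    proof cases
      case 1
      then show ?thesis using d v by (auto simp: \<pi>_def)
    next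
      case 2
      have "(tail G e, head G e') \<in> adjacency K" "(head G e', tail G e) \<in> adjacency K"
        using e neq by (auto simp: adjacency_def K_simps intro!: bexI[of _ e])
      then show ?thesis using d v 2 by (auto simp: \<pi>_def)
    next
      case 3
      then have "(a, b) \<in> adjacency K"
        using d by (force simp: adjacency_def K_simps)
      then show ?thesis using d others[OF d(1) 3] by (auto simp: \<pi>_def)
    qed
  qed
  have reach: "(\<pi> a, \<pi> b) \<in> (adjacency K)\<^sup>*" if "(a, b) \<in> (adjacency G)\<^sup>*" for a b
    using that by (induction rule: rtrancl_induct) (auto intro: rtrancl_trans step)
  have ends: "tail K d \<in> verts K \<and> head K d \<in> verts K" if "d \<in> edges K" for d
    using that v others[of d] G.tail_in[of d] G.head_in[of d] G.head_in[OF e'] by (auto simp: K_simps)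
  have K: "connected_wgraph K"
  proof
    show "verts K \<noteq> {}" using G.tail_in[OF e] v by (auto simp: K_simps)
    show "(a, b) \<in> (adjacency K)\<^sup>*" if "a \<in> verts K" "b \<in> verts K" for a b
      using that reach[OF G.connected, of a b] by (auto simp: K_simps \<pi>_def)
  qed (use G.finite_verts G.finite_edges G.elen_pos ends e e' in
      \<open>auto simp: K_simps intro: add_pos_pos\<close>)
  interpret K: subdivision K e "elen G e" v e'
    using K e e' neq G.elen_pos
    by (intro subdivision.intro subdivision_axioms.intro) (auto simp: K_simps)
  have "v \<in> verts G" using G.head_in[OF e] v by simp
  then have K_sub: "subdivide K e (elen G e) v e' = G"
    using neq e' v by (intro wgraph.equality) (auto simp: subdivide_def K_simps)
  obtain g where g: "graph_isometry K G g" "\<forall>x\<in>verts K. g (Vertex x) = Vertex x"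
    using K.subdivide_isometry by (auto simp: K_sub)
  define h where "h = inv_into (points K) g"
  show thesis
  proof (rule that[of K h])
    show "connected_wgraph K" by fact
    show "graph_isometry G K h" using graph_isometry_inv[OF g(1)] by (simp add: h_def)
    show "\<forall>x\<in>verts G - {v}. x \<in> verts K \<and> h (Vertex x) = Vertex x"
    proof
      fix x assume "x \<in> verts G - {v}"
      then have x: "x \<in> verts K" by (simp add: K_simps)
      moreover have "inj_on g (points K)" using g(1) by (simp add: graph_isometry_def bij_betw_def)
      ultimately show "x \<in> verts K \<and> h (Vertex x) = Vertex x"
        using inv_into_f_f[of g "points K" "Vertex x"] g(2) by (simp add: h_def)
    qed
    show "leaves K = leaves G" "cyc K = cyc G"
      using K.subdivide_leaves K.subdivide_cyc by (simp_all add: K_sub)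
    show "card (edges K) < card (edges G)"
      using e' G.finite_edges by (simp add: K_simps card_Diff1_less del: card_Diff_insert)
  qed
qed

text \<open>Since \<open>e\<close> uses up one of the two incidences at \<open>v\<close>, exactly
  one other edge \<open>e'\<close> has the remaining one. Reversing edges where necessary reduces to
  \<open>merge_oriented\<close>. The condition on \<open>e\<close> excludes a single loop at
  \<open>v\<close>, which has nothing to merge with.\<close>

lemma merge:
  fixes G :: "('v, 'e) wgraph"
  assumes G: "connected_wgraph G" and e: "e \<in> edges G"
    and v: "v \<in> verts G" "degree G v = 2" "incidences G v e = 1"
  obtains K :: "('v, 'e) wgraph" and g where "connected_wgraph K" "graph_isometry G K g"
    "\<forall>x\<in>verts G - {v}. x \<in> verts K \<and> g (Vertex x) = Vertex x"
    "card (leaves K) = card (leaves G)" "cyc K = cyc G" "card (edges K) < card (edges G)"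
proof -
  interpret G: connected_wgraph G by fact
  have "(\<Sum>d\<in>edges G - {e}. incidences G v d) = 1"
    using v e G.finite_edges by (simp add: degree_eq_sum sum.remove[of "edges G" e])
  then have "\<exists>e'\<in>edges G - {e}. incidences G v e' = 1 \<and>
      (\<forall>d\<in>edges G - {e}. e' \<noteq> d \<longrightarrow> incidences G v d = 0)"
    using sum_eq_1_iff[of "edges G - {e}" "incidences G v"] G.finite_edges by blast
  then obtain e' where "e' \<in> edges G - {e}" and "incidences G v e' = 1"
    and zero: "\<forall>d\<in>edges G - {e}. e' \<noteq> d \<longrightarrow> incidences G v d = 0"
    by blast
  then have e': "e' \<in> edges G" "e \<noteq> e'" "incidences G v e' = 1" by auto
  have others: "incidences G v d = 0" if "d \<in> edges G" "d \<noteq> e" "d \<noteq> e'" for d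
    using zero that by simp
  \<comment> \<open>The edges to be reversed, so that \<open>e\<close> ends at \<open>v\<close> and
    \<open>e'\<close> starts there.\<close>
  define F where "F = {d. (d = e \<and> head G d \<noteq> v) \<or> (d = e' \<and> tail G d \<noteq> v)}"
  define K where "K = G\<lparr>tail := \<lambda>d. if d \<in> F then head G d else tail G d,
    head := \<lambda>d. if d \<in> F then tail G d else head G d\<rparr>"
  have K_simps: "verts K = verts G" "edges K = edges G" "elen K = elen G"
    "tail K d = (if d \<in> F then head G d else tail G d)"
    "head K d = (if d \<in> F then tail G d else head G d)" for d
    by (simp_all add: K_def)
  have rel: "connected_wgraph K" "card (leaves K) = card (leaves G)" "cyc K = cyc G"
    "\<exists>g. graph_isometry G K g \<and> (\<forall>v\<in>verts G. g (Vertex v) = Vertex (id v))"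
    by (rule relabel[OF G, of id K id]; simp add: K_simps)+
  then obtain g where g: "graph_isometry G K g" "\<And>x. x \<in> verts G \<Longrightarrow> g (Vertex x) = Vertex x"
    by auto
  have ends: "head K e = v" "tail K e' = v" "tail K e \<noteq> v" "head K e' \<noteq> v"
  proof -
    have one_end: "(tail G d = v) \<noteq> (head G d = v)" if "incidences G v d = 1" for d
      using that by (cases "tail G d = v"; cases "head G d = v") (simp_all add: incidences_def)
    show "head K e = v" "tail K e' = v" "tail K e \<noteq> v" "head K e' \<noteq> v"
      using one_end[OF v(3)] one_end[OF e'(3)] e'(2) unfolding K_simps F_def
      by (cases "tail G e = v"; cases "tail G e' = v"; simp)+
  qed
  have K_others: "tail K d \<noteq> v \<and> head K d \<noteq> v" if "d \<in> edges K" "d \<noteq> e" "d \<noteq> e'" for d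
    using that others[of d] by (simp add: K_simps F_def incidences_def)
  have eK: "e \<in> edges K" "e' \<in> edges K" using e e' by (simp_all add: K_simps)
  obtain L :: "('v, 'e) wgraph" and h where L: "connected_wgraph L" "graph_isometry K L h"
    "\<forall>x\<in>verts K - {v}. x \<in> verts L \<and> h (Vertex x) = Vertex x"
    "leaves L = leaves K" "cyc L = cyc K" "card (edges L) < card (edges K)"
    by (rule merge_oriented[OF rel(1) eK e'(2) ends K_others])
  show thesis
    by (rule that[OF L(1) graph_isometry_comp[OF g(1) L(2)]])
      (use L g(2) rel in \<open>auto simp: K_simps\<close>)
qed

section \<open>The centre\<close>

context connected_wgraph
begin

text \<open>Every point is within \<open>total_length G\<close> of a vertex, and there are finitely
  many vertices. This makes the supremum in the eccentricity a genuine upper bound.\<close>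

lemma bdd_above_dist:
  assumes "x \<in> points G" shows "bdd_above (graph_dist G x ` points G)"
proof -
  define S where "S = (\<Sum>v\<in>verts G. graph_dist G x (Vertex v))"
  have S: "graph_dist G x (Vertex v) \<le> S" if "v \<in> verts G" for v
    unfolding S_def using that finite_verts by (intro member_le_sum dist_nonneg) auto
  have len: "elen G e \<le> total_length G" if "e \<in> edges G" for e
    unfolding total_length_def using that finite_edges elen_pos
    by (intro member_le_sum) (auto intro: less_imp_le)
  have "0 \<le> total_length G"
    unfolding total_length_def using elen_pos by (intro sum_nonneg) (auto intro: less_imp_le)
  have "graph_dist G x y \<le> S + total_length G" if "y \<in> points G" for y
    using that
  proof (cases rule: points_cases)
    case (1 v)
    then show ?thesis using S[of v] \<open>0 \<le> total_length G\<close> by simp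
  next
    case (2 e t)
    have "graph_dist G x y \<le> graph_dist G x (Vertex (tail G e)) + graph_dist G (Vertex (tail G e)) y"
      using assms that tail_in 2 by (intro dist_triangle) auto
    moreover have "graph_dist G (Vertex (tail G e)) y \<le> t"
      using dist_point_at_le[of e 0 t] 2 by (simp add: point_at_Inner)
    ultimately show ?thesis using S[OF tail_in] len 2 by fastforce
  qed
  then show ?thesis by (auto intro!: bdd_aboveI)
qed

text \<open>The eccentricity is 1-Lipschitz, hence attains its minimum on each closed edge; the
  least of these finitely many values is the global minimum.\<close>

lemma center_exists:
  "\<exists>c\<in>points G. \<forall>y\<in>points G.
     graph_dist G c y \<le> (INF x\<in>points G. SUP y\<in>points G. graph_dist G x y)"
proof -
  define ecc where "ecc = (\<lambda>x. SUP y\<in>points G. graph_dist G x y)"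
  have ne: "points G \<noteq> {}" using verts_nonempty by (auto simp: points_eq)
  have upper: "graph_dist G x y \<le> ecc x" if "x \<in> points G" "y \<in> points G" for x y
    unfolding ecc_def using that bdd_above_dist by (intro cSUP_upper) auto
  have lip: "ecc x \<le> graph_dist G x z + ecc z" if x: "x \<in> points G" and z: "z \<in> points G" for x z
  proof -
    have "(SUP y\<in>points G. graph_dist G x y) \<le> graph_dist G x z + ecc z"
    proof (rule cSUP_least[OF ne])
      fix y assume y: "y \<in> points G"
      show "graph_dist G x y \<le> graph_dist G x z + ecc z"
        using dist_triangle[OF x z y] upper[OF z y] by linarith
    qed
    then show ?thesis by (simp add: ecc_def)
  qed
  have "\<exists>m\<in>{0..elen G e}. \<forall>t\<in>{0..elen G e}. ecc (point_at G e m) \<le> ecc (point_at G e t)"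
    if e: "e \<in> edges G" for e
  proof (rule continuous_attains_inf)
    have "1-lipschitz_on {0..elen G e} (\<lambda>t. ecc (point_at G e t))"
    proof (rule lipschitz_onI)
      fix s t assume st: "s \<in> {0..elen G e}" "t \<in> {0..elen G e}"
      then have "graph_dist G (point_at G e s) (point_at G e t) \<le> \<bar>s - t\<bar>"
        using dist_point_at_le[OF e] by auto
      then show "dist (ecc (point_at G e s)) (ecc (point_at G e t)) \<le> 1 * dist s t"
        using lip[of "point_at G e s" "point_at G e t"] lip[of "point_at G e t" "point_at G e s"]
          point_at_in_points[OF e] st graph_dist_commute[of "point_at G e s" "point_at G e t"]
        by (simp add: dist_real_def)
    qed simp
    then show "continuous_on {0..elen G e} (\<lambda>t. ecc (point_at G e t))"
      by (rule lipschitz_on_continuous_on)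
  qed (use elen_pos[OF e] in auto)
  then obtain m where m: "\<And>e. e \<in> edges G \<Longrightarrow> m e \<in> {0..elen G e}"
    "\<And>e t. \<lbrakk>e \<in> edges G; t \<in> {0..elen G e}\<rbrakk> \<Longrightarrow> ecc (point_at G e (m e)) \<le> ecc (point_at G e t)"
    by metis
  \<comment> \<open>Including the vertices keeps \<open>C\<close> nonempty for a graph without
    edges.\<close>
  define C where "C = Vertex ` verts G \<union> (\<lambda>e. point_at G e (m e)) ` edges G"
  have C: "finite C" "C \<noteq> {}"
    using finite_verts finite_edges verts_nonempty by (auto simp: C_def)
  have C_points: "C \<subseteq> points G"
    using point_at_in_points[OF _ m(1)] by (auto simp: C_def)
  obtain c where c: "c \<in> C" "\<And>x. x \<in> C \<Longrightarrow> ecc c \<le> ecc x"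
    using ex_is_arg_min_if_finite[OF C, of ecc] by (auto simp: is_arg_min_linorder)
  have "ecc c \<le> ecc x" if "x \<in> points G" for x
    using that
  proof (cases rule: points_cases)
    case (2 e t)
    then have "ecc (point_at G e (m e)) \<le> ecc x" using m(2)[of e t] by (simp add: point_at_Inner)
    moreover have "ecc c \<le> ecc (point_at G e (m e))" using 2 by (intro c(2)) (auto simp: C_def)
    ultimately show ?thesis by linarith
  qed (auto simp: C_def intro!: c(2))
  then have "ecc c \<le> (INF x\<in>points G. ecc x)" using ne by (intro cINF_greatest) auto
  then show ?thesis
    using c(1) C_points upper unfolding ecc_def by (meson order_trans subsetD)
qed

end

section \<open>Distances from a vertex\<close>

context connected_wgraph
begin

text \<open>The distance from \<open>u\<close> is the largest potential \<open>F\<close> with \<open>F u = 0\<close> that changes by at most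
  the length along every edge.\<close>

lemma potential_le_dist:
  fixes F :: "'v \<Rightarrow> real"
  assumes F: "\<And>e. e \<in> edges G \<Longrightarrow> \<bar>F (tail G e) - F (head G e)\<bar> \<le> elen G e"
    and u: "u \<in> verts G"
  shows "v \<in> verts G \<Longrightarrow> F v - F u \<le> graph_dist G (Vertex u) (Vertex v)"
    and "\<lbrakk>e \<in> edges G; 0 \<le> t; t \<le> elen G e\<rbrakk> \<Longrightarrow>
      min (F (tail G e) + t) (F (head G e) + elen G e - t) - F u
        \<le> graph_dist G (Vertex u) (point_at G e t)"
proof -
  \<comment> \<open>On each edge, the largest 1-Lipschitz function with the values of
    \<open>F\<close> at the ends. The hypothesis \<open>F\<close> ensures that the minimum takes
    these values at \<open>t = 0\<close> and \<open>t = elen G e\<close>.\<close>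
  define g where "g = (\<lambda>x :: ('v, 'e) point. case x of Vertex v \<Rightarrow> F v |
    Inner e t \<Rightarrow> min (F (tail G e) + t) (F (head G e) + elen G e - t))"
  have g_at: "g (point_at G e t) = min (F (tail G e) + t) (F (head G e) + elen G e - t)"
    if "e \<in> edges G" "0 \<le> t" "t \<le> elen G e" for e t
    using that F[OF that(1)] elen_pos[OF that(1)] by (auto simp: g_def point_at_def min_def)
  have g: "g x - g (Vertex u) \<le> graph_dist G (Vertex u) x" if "x \<in> points G" for x
  proof -
    have "\<bar>g (Vertex u) - g x\<bar> \<le> graph_dist G (Vertex u) x"
    proof (rule graph_dist_lipschitz)
      fix e s t assume "e \<in> edges G" "0 \<le> s" "s \<le> t" "t \<le> elen G e"
      then show "\<bar>g (point_at G e s) - g (point_at G e t)\<bar> \<le> t - s"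
        by (auto simp: g_at min_def)
    qed (use that u in auto)
    then show ?thesis by linarith
  qed
  show "F v - F u \<le> graph_dist G (Vertex u) (Vertex v)" if "v \<in> verts G"
    using g[of "Vertex v"] that by (simp add: g_def)
  show "min (F (tail G e) + t) (F (head G e) + elen G e - t) - F u
        \<le> graph_dist G (Vertex u) (point_at G e t)"
    if e: "e \<in> edges G" "0 \<le> t" "t \<le> elen G e"
    using g[OF point_at_in_points[OF e(1)], of t] g_at[OF e] e by (simp add: g_def)
qed

lemma dist_edge_le:
  assumes u: "u \<in> verts G" and e: "e \<in> edges G"
  shows "\<bar>graph_dist G (Vertex u) (Vertex (tail G e)) - graph_dist G (Vertex u) (Vertex (head G e))\<bar>
    \<le> elen G e"
proof -
  have "graph_dist G (Vertex (tail G e)) (Vertex (head G e)) \<le> elen G e"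
    using dist_point_at_le[OF e, of 0 "elen G e"] e elen_pos[OF e] by simp
  then show ?thesis
    using dist_triangle[of "Vertex u" "Vertex (tail G e)" "Vertex (head G e)"]
      dist_triangle[of "Vertex u" "Vertex (head G e)" "Vertex (tail G e)"]
      graph_dist_commute[of "Vertex (tail G e)" "Vertex (head G e)"] u tail_in[OF e] head_in[OF e]
    by simp
qed

text \<open>At the point where the routes through the two ends are equally long, the distance from
  \<open>u\<close> is at least half the sum of \<open>elen G e\<close> and the distances of both
  ends; it is also at most \<open>R\<close>.\<close>

lemma elen_le_eccentricity:
  assumes u: "u \<in> verts G" and e: "e \<in> edges G"
    and R: "\<And>y. y \<in> points G \<Longrightarrow> graph_dist G (Vertex u) y \<le> R"
  shows "elen G e \<le> 2 * R - graph_dist G (Vertex u) (Vertex (tail G e))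
    - graph_dist G (Vertex u) (Vertex (head G e))"
proof -
  define f where "f = (\<lambda>v. graph_dist G (Vertex u) (Vertex v))"
  \<comment> \<open>the point of the edge that is farthest from \<open>u\<close>\<close>
  define t where "t = (f (head G e) + elen G e - f (tail G e)) / 2"
  have f_edge: "\<bar>f (tail G d) - f (head G d)\<bar> \<le> elen G d" if "d \<in> edges G" for d
    using dist_edge_le[OF u that] by (simp add: f_def)
  have "f u = 0" using dist_zero u by (simp add: f_def)
  have t: "0 \<le> t" "t \<le> elen G e" using f_edge[OF e] by (auto simp: t_def)
  have "min (f (tail G e) + t) (f (head G e) + elen G e - t) \<le> R"
    using potential_le_dist(2)[of f, OF f_edge u e t] \<open>f u = 0\<close>
      R[OF point_at_in_points[OF e, of t]] t by simp
  then have "elen G e \<le> 2 * R - f (tail G e) - f (head G e)"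
    unfolding t_def by (simp add: field_simps min_def split: if_splits)
  then show ?thesis by (simp add: f_def)
qed

section \<open>Parent edges and weighted degree sums\<close>

definition other_end :: "'e \<Rightarrow> 'v \<Rightarrow> 'v" where
  "other_end e v = (if tail G e = v then head G e else tail G e)"

text \<open>Otherwise every non-loop edge at \<open>v\<close> has slack, and raising the distance
  function at \<open>v\<close> by the least slack gives an admissible potential that exceeds the
  distance. This needs no shortest path as an object.\<close>

lemma parent_edge_exists:
  assumes u: "u \<in> verts G" and v: "v \<in> verts G" and "v \<noteq> u"
  shows "\<exists>e\<in>edges G. incidences G v e = 1 \<and>
    graph_dist G (Vertex u) (Vertex v) =
      graph_dist G (Vertex u) (Vertex (other_end e v)) + elen G e"
proof (rule ccontr)
  define f where "f = (\<lambda>v. graph_dist G (Vertex u) (Vertex v))"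
  define I where "I = {e \<in> edges G. incidences G v e = 1}"
  define D where "D = (\<lambda>e. f (other_end e v) + elen G e - f v) ` I"
  \<comment> \<open>The inserted 1 makes the minimum meaningful and positive even if no non-loop
    edge meets \<open>v\<close>.\<close>
  define \<delta> where "\<delta> = Min (insert 1 D)"
  have f_edge: "\<bar>f (tail G d) - f (head G d)\<bar> \<le> elen G d" if "d \<in> edges G" for d
    using dist_edge_le[OF u that] by (simp add: f_def)
  have finI: "finite I" using finite_edges by (simp add: I_def)
  assume "\<not> ?thesis"
  then have neq: "f v \<noteq> f (other_end e v) + elen G e" if "e \<in> I" for e
    using that by (auto simp: I_def f_def)
  have "0 < f (other_end e v) + elen G e - f v" if "e \<in> I" for e
    using neq[OF that] f_edge[of e] that
    by (auto simp: I_def other_end_def incidences_def of_bool_def split: if_splits)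
  then have "0 < \<delta>" using finI by (auto simp: \<delta>_def D_def)
  have \<delta>_le: "\<delta> \<le> f (other_end e v) + elen G e - f v" if "e \<in> I" for e
    using finI that by (auto simp: \<delta>_def D_def intro: Min_le)
  define F where "F = f(v := f v + \<delta>)"
  have "\<bar>F (tail G e) - F (head G e)\<bar> \<le> elen G e" if e: "e \<in> edges G" for e
  proof (cases "e \<in> I")
    case True
    then show ?thesis using \<delta>_le[OF True] \<open>0 < \<delta>\<close> f_edge[OF e]
      by (auto simp: F_def I_def other_end_def incidences_def of_bool_def split: if_splits)
  next
    \<comment> \<open>Such an edge misses \<open>v\<close> or is a loop at \<open>v\<close>; raising
      the value at \<open>v\<close> does not affect the difference at its ends.\<close>
    case False
    then show ?thesis using e f_edge[OF e] elen_pos[OF e]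
      by (auto simp: F_def I_def incidences_def of_bool_def split: if_splits)
  qed
  then have "F v - F u \<le> f v" using potential_le_dist(1)[of F u v] u v by (simp add: f_def)
  moreover have "f u = 0" using dist_zero u by (simp add: f_def)
  ultimately show False using \<open>0 < \<delta>\<close> \<open>v \<noteq> u\<close> by (simp add: F_def)
qed

text \<open>The handshake lemma with vertex weights, by double counting the incidences.\<close>

lemma sum_degree:
  fixes f :: "'v \<Rightarrow> real"
  shows "(\<Sum>v\<in>verts G. f v * degree G v) = (\<Sum>e\<in>edges G. f (tail G e) + f (head G e))"
proof -
  have "(\<Sum>v\<in>verts G. f v * degree G v) =
      (\<Sum>v\<in>verts G. \<Sum>e\<in>edges G. f v * incidences G v e)"
    by (simp add: degree_eq_sum finite_edges sum_distrib_left)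
  also have "\<dots> = (\<Sum>e\<in>edges G. \<Sum>v\<in>verts G. f v * incidences G v e)"
    by (rule sum.swap)
  also have "\<dots> = (\<Sum>e\<in>edges G. f (tail G e) + f (head G e))"
  proof (rule sum.cong[OF refl])
    fix e assume e: "e \<in> edges G"
    have "(\<Sum>v\<in>verts G. f v * of_bool (w = v)) = f w" if "w \<in> verts G" for w
      using that finite_verts by (simp add: of_bool_def if_distrib cong: if_cong)
    then show "(\<Sum>v\<in>verts G. f v * incidences G v e) = f (tail G e) + f (head G e)"
      using tail_in[OF e] head_in[OF e]
      by (simp add: incidences_def distrib_left sum.distrib)
  qed
  finally show ?thesis .
qed

end

section \<open>The extremal graphs\<close>

context connected_wgraph
begin

lemma incidences_eq_1:
  assumes "incidences G v e = 1"
  shows "other_end e v \<noteq> v"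
    and "(tail G e = v \<and> head G e = other_end e v) \<or> (tail G e = other_end e v \<and> head G e = v)"
  using assms by (cases "tail G e = v"; cases "head G e = v"; simp add: incidences_def other_end_def)+

text \<open>The defect \<open>(2 cyc + l) R - len\<close>, with \<open>l\<close> the number of
  leaves, is a sum of three nonnegative parts: the slack \<open>A\<close> of the non-parent edges,
  the slack \<open>B\<close> of the vertices other than \<open>u\<close>, and
  \<open>R * leaf u\<close>. Equality forces every summand to vanish.\<close>

lemma extremal_constraints:
  assumes u: "u \<in> verts G" and R: "\<And>y. y \<in> points G \<Longrightarrow> graph_dist G (Vertex u) y \<le> R"
    and len: "total_length G = of_int (2 * cyc G + int (card (leaves G))) * R"
  shows "u \<notin> leaves G"
    and "\<And>v. \<lbrakk>v \<in> verts G; v \<noteq> u\<rbrakk> \<Longrightarrow> degree G v \<noteq> 2 \<Longrightarrow>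
      v \<in> leaves G \<and> graph_dist G (Vertex u) (Vertex v) = R"
    and "\<And>e. \<lbrakk>e \<in> edges G; tail G e = u; head G e = u\<rbrakk> \<Longrightarrow> elen G e = 2 * R"
proof -
  define f where "f = (\<lambda>v. graph_dist G (Vertex u) (Vertex v))"
  define V where "V = verts G - {u}"
  have finV: "finite V" using finite_verts by (simp add: V_def)
  have f_u: "f u = 0" using dist_zero u by (simp add: f_def)
  have f_pos: "0 < f v" if "v \<in> V" for v
    using that dist_nonneg[of "Vertex u" "Vertex v"] dist_zero[of "Vertex u" "Vertex v"] u
    by (auto simp: f_def V_def less_le)
  have f_le: "f v \<le> R" if "v \<in> verts G" for v using R that by (simp add: f_def)
  have "\<forall>v\<in>V. \<exists>e\<in>edges G. incidences G v e = 1 \<and> f v = f (other_end e v) + elen G e"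
    using parent_edge_exists[OF u] by (simp add: f_def V_def)
  then obtain p where p: "\<And>v. v \<in> V \<Longrightarrow> p v \<in> edges G" "\<And>v. v \<in> V \<Longrightarrow> incidences G v (p v) = 1"
    "\<And>v. v \<in> V \<Longrightarrow> f v = f (other_end (p v) v) + elen G (p v)"
    by metis
  have p_ends: "f (other_end (p v) v) + f v = f (tail G (p v)) + f (head G (p v))" if "v \<in> V" for v
    using incidences_eq_1(2)[OF p(2)[OF that]] by auto
  \<comment> \<open>If two vertices shared a parent edge, each would be the other end for the other
    one, and both would be strictly farther from \<open>u\<close>.\<close>
  have p_inj: "inj_on p V"
  proof (rule inj_onI, rule ccontr)
    fix v w assume vw: "v \<in> V" "w \<in> V" "p v = p w" "v \<noteq> w"
    then have "other_end (p v) v = w" "other_end (p w) w = v"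
      using incidences_eq_1[OF p(2)] by metis+
    then show False using p(3)[of v] p(3)[of w] p(1)[of v] elen_pos[of "p v"] vw by simp
  qed
  \<comment> \<open>The edges of a shortest path tree: one for each vertex other than
    \<open>u\<close>, which leaves \<open>cyc G\<close> edges outside.\<close>
  define T where "T = p ` V"
  define s where "s = (\<lambda>e. f (tail G e) + f (head G e))"
  have T: "T \<subseteq> edges G" using p(1) by (auto simp: T_def)
  have elen_T: "(\<Sum>e\<in>T. elen G e) = (\<Sum>v\<in>V. 2 * f v) - (\<Sum>e\<in>T. s e)"
  proof -
    have "(\<Sum>e\<in>T. elen G e + s e) = (\<Sum>v\<in>V. elen G (p v) + s (p v))"
      using p_inj by (simp add: T_def sum.reindex)
    also have "\<dots> = (\<Sum>v\<in>V. 2 * f v)"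
    proof (rule sum.cong[OF refl])
      fix v assume "v \<in> V"
      then show "elen G (p v) + s (p v) = 2 * f v"
        using p(3)[of v] p_ends[of v] unfolding s_def by linarith
    qed
    finally show ?thesis by (simp add: sum.distrib)
  qed
  have elen_le: "elen G e \<le> 2 * R - s e" if "e \<in> edges G" for e
    using elen_le_eccentricity[OF u that R] by (simp add: f_def s_def)
  have card_V: "card (verts G) = card V + 1"
    using card_Suc_Diff1[OF finite_verts u] unfolding V_def by linarith
  have card_nontree: "real (card (edges G - T)) = of_int (cyc G)"
  proof -
    have "card T = card V" using p_inj by (simp add: T_def card_image)
    moreover have "card (edges G) = card (edges G - T) + card T"
      using card_Diff_subset[of T "edges G"] card_mono[OF finite_edges T]
        finite_subset[OF T finite_edges] T by simp
    ultimately have "int (card (edges G - T)) = cyc G" using card_V by (simp add: cyc_def)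
    then show ?thesis by (metis of_int_of_nat_eq)
  qed
  have sum_s: "(\<Sum>e\<in>edges G. s e) = (\<Sum>v\<in>V. f v * degree G v)"
    using sum_degree[of f] u f_u finite_verts by (simp add: s_def V_def sum.remove[of "verts G" u])
  have split: "(\<Sum>e\<in>edges G. h e) = (\<Sum>e\<in>edges G - T. h e) + (\<Sum>e\<in>T. h e)" for h :: "'e \<Rightarrow> real"
    using T finite_edges by (rule sum.subset_diff)
  define leaf where "leaf = (\<lambda>v. of_bool (degree G v = 1) :: real)"
  have card_leaves: "real (card (leaves G)) = leaf u + (\<Sum>v\<in>V. leaf v)"
  proof -
    have "real (card (leaves G)) = (\<Sum>v\<in>verts G. leaf v)"
      using finite_verts by (simp add: leaf_def leaves_def sum_of_bool_eq Int_def)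
    then show ?thesis using u finite_verts by (simp add: V_def sum.remove[of "verts G" u])
  qed
  \<comment> \<open>A leaf contributes \<open>f v\<close>, at most \<open>R\<close>; from degree 2
    on, the left side is not positive. Degree 0 is excluded by the parent edge.\<close>
  have vertex_le: "2 * f v - f v * degree G v \<le> R * leaf v" if v: "v \<in> V" for v
  proof -
    have "1 \<le> degree G v"
      using p(1,2)[OF v] member_le_sum[of "p v" "edges G" "incidences G v"] finite_edges
      by (simp add: degree_eq_sum)
    then consider "degree G v = 1" | "2 \<le> degree G v" by linarith
    then show ?thesis
    proof cases
      case 1
      then show ?thesis using f_le v by (simp add: leaf_def V_def)
    next
      case 2
      then have "f v * 2 \<le> f v * degree G v" using f_pos[OF v] by (intro mult_left_mono) auto
      then show ?thesis using 2 by (simp add: leaf_def)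
    qed
  qed
  have "0 \<le> R" using f_le[OF u] f_u by simp
  define A where "A = (\<Sum>e\<in>edges G - T. 2 * R - s e - elen G e)"
  define B where "B = (\<Sum>v\<in>V. R * leaf v - (2 * f v - f v * degree G v))"
  \<comment> \<open>The end terms \<open>s\<close> of tree and non-tree edges add up to the
    degree-weighted sum of \<open>f\<close>, in which \<open>u\<close> drops out because
    \<open>f u = 0\<close>.\<close>
  have "A + B + R * leaf u = 0"
  proof -
    have "A = 2 * R * of_int (cyc G) - (\<Sum>e\<in>edges G - T. s e) - (\<Sum>e\<in>edges G - T. elen G e)"
      by (simp add: A_def sum_subtractf card_nontree)
    moreover have "B = R * (\<Sum>v\<in>V. leaf v) - (\<Sum>v\<in>V. 2 * f v) + (\<Sum>v\<in>V. f v * degree G v)"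
      by (simp add: B_def sum_subtractf sum_distrib_left)
    moreover have "total_length G = 2 * R * of_int (cyc G) + R * leaf u + R * (\<Sum>v\<in>V. leaf v)"
      using len card_leaves by (simp add: algebra_simps)
    ultimately show ?thesis
      using elen_T sum_s split[of s] split[of "elen G"] unfolding total_length_def by linarith
  qed
  moreover have "0 \<le> A" unfolding A_def using elen_le by (intro sum_nonneg) auto
  moreover have "0 \<le> B" unfolding B_def using vertex_le by (intro sum_nonneg) auto
  moreover have "0 \<le> R * leaf u" using \<open>0 \<le> R\<close> by (simp add: leaf_def)
  ultimately have zero: "A = 0" "B = 0" "R * leaf u = 0" by linarith+
  \<comment> \<open>Parent edges are not loops, so the loops at \<open>u\<close> are among the edges
    counted in \<open>A\<close>.\<close>
  have loop_not_T: "e \<notin> T" if "tail G e = u" "head G e = u" for e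
  proof
    assume "e \<in> T"
    then obtain v where "v \<in> V" "e = p v" by (auto simp: T_def)
    then show False using p(2)[of v] that by (auto simp: V_def incidences_def)
  qed
  show "elen G e = 2 * R" if e: "e \<in> edges G" "tail G e = u" "head G e = u" for e
  proof -
    have "2 * R - s e - elen G e = 0"
      using zero(1) loop_not_T[OF e(2,3)] e(1) finite_edges elen_le unfolding A_def
      by (subst (asm) sum_nonneg_eq_0_iff) auto
    then show ?thesis using f_u e by (simp add: s_def)
  qed
  have vertex_eq: "R * leaf v = 2 * f v - f v * degree G v" if "v \<in> V" for v
    using zero(2) finV vertex_le that unfolding B_def
    by (subst (asm) sum_nonneg_eq_0_iff) auto
  show "v \<in> leaves G \<and> graph_dist G (Vertex u) (Vertex v) = R"
    if v: "v \<in> verts G" "v \<noteq> u" "degree G v \<noteq> 2" for v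
  proof (cases "degree G v = 1")
    case True
    then show ?thesis using vertex_eq[of v] v by (simp add: leaf_def V_def leaves_def f_def)
  next
    case False
    then have "f v * (2 - real (degree G v)) = 0"
      using vertex_eq[of v] v by (simp add: leaf_def V_def algebra_simps)
    then show ?thesis using f_pos[of v] v by (simp add: V_def)
  qed
  \<comment> \<open>A leaf \<open>u\<close> would force \<open>R = 0\<close>, so \<open>u\<close>
    would be the only vertex and every edge a loop; but then its degree is even.\<close>
  show "u \<notin> leaves G"
  proof
    assume "u \<in> leaves G"
    then have deg: "degree G u = 1" by (simp add: leaves_def)
    then have "R = 0" using zero(3) by (simp add: leaf_def)
    then have "V = {}" using f_pos f_le by (force simp: V_def)
    then have "incidences G u e = 2" if "e \<in> edges G" for e
      using tail_in[OF that] head_in[OF that] by (auto simp: V_def incidences_def)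
    then have "degree G u = card (edges G) * 2" by (simp add: degree_eq_sum finite_edges)
    then show False using deg by simp
  qed
qed

section \<open>Recognising and measuring the star\<close>

text \<open>All vertices other than \<open>u\<close> are equally far from \<open>u\<close>, so the
  parent edge of each leaf starts at \<open>u\<close>. It is the only edge at that leaf, hence the
  remaining edges are loops at \<open>u\<close>.\<close>

lemma star_with_loopsI:
  assumes u: "u \<in> verts G" "u \<notin> leaves G"
    and leaf: "\<And>v. \<lbrakk>v \<in> verts G; v \<noteq> u\<rbrakk> \<Longrightarrow>
      v \<in> leaves G \<and> graph_dist G (Vertex u) (Vertex v) = R"
    and loop: "\<And>e. \<lbrakk>e \<in> edges G; tail G e = u; head G e = u\<rbrakk> \<Longrightarrow> elen G e = 2 * R"
  shows "star_with_loops G (card (leaves G)) (cyc G) R"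
proof -
  have leaves: "leaves G = verts G - {u}" using u leaf by (auto simp: leaves_def)
  have unique: "d = e" if "v \<in> leaves G" "d \<in> edges G" "e \<in> edges G"
    "incidences G v d > 0" "incidences G v e > 0" for v d e
  proof (rule ccontr)
    assume "d \<noteq> e"
    have "sum (incidences G v) {d, e} \<le> sum (incidences G v) (edges G)"
      using that finite_edges by (intro sum_mono2) auto
    also have "\<dots> = 1" using that(1) finite_edges by (simp add: leaves_def degree_eq_sum)
    finally show False using that \<open>d \<noteq> e\<close> by simp
  qed
  define B where "B = {e \<in> edges G. tail G e = u \<and> head G e = u}"
  define A where "A = edges G - B"
  define w where "w = (\<lambda>e. if tail G e = u then head G e else tail G e)"
  have R_pos: "0 < R" if "v \<in> leaves G" for v
    using leaf[of v] that dist_nonneg[of "Vertex u" "Vertex v"] dist_zero[of "Vertex u" "Vertex v"] u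
    by (auto simp: leaves less_le)
  have parent: "\<exists>e\<in>edges G. incidences G v e = 1 \<and> other_end e v = u \<and> elen G e = R"
    if v: "v \<in> leaves G" for v
  proof -
    obtain e where e: "e \<in> edges G" "incidences G v e = 1"
      "R = graph_dist G (Vertex u) (Vertex (other_end e v)) + elen G e"
      using parent_edge_exists[OF u(1), of v] leaf[of v] v unfolding leaves by force
    have "other_end e v \<in> verts G"
      using tail_in head_in e(1) by (simp add: other_end_def)
    \<comment> \<open>Any other vertex is itself at distance \<open>R\<close>, which contradicts the
      positive length of \<open>e\<close>.\<close>
    then have "other_end e v = u" using leaf[of "other_end e v"] e elen_pos[of e] by force
    moreover have "graph_dist G (Vertex u) (Vertex u) = 0" using u dist_zero by simp
    ultimately show ?thesis using e by auto
  qed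
  have A: "w e \<in> leaves G \<and> {tail G e, head G e} = {u, w e} \<and> elen G e = R" if e: "e \<in> A" for e
  proof -
    have eE: "e \<in> edges G" using e by (simp add: A_def)
    have we: "w e \<in> leaves G" "incidences G (w e) e > 0"
      using e tail_in[OF eE] head_in[OF eE] by (auto simp: A_def B_def w_def leaves incidences_def)
    obtain d where d: "d \<in> edges G" "incidences G (w e) d = 1" "other_end d (w e) = u" "elen G d = R"
      using parent[OF we(1)] by blast
    \<comment> \<open>An edge in \<open>A\<close> has a leaf as an end and therefore is the parent
      edge of that leaf.\<close>
    have "d = e" using unique[OF we(1) d(1) eE] we(2) d(2) by simp
    moreover have "{tail G d, head G d} = {w e, other_end d (w e)}"
      using incidences_eq_1(2)[OF d(2)] by auto
    ultimately show ?thesis using we d by auto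
  qed
  have "bij_betw w A (leaves G)"
    unfolding bij_betw_def
  proof
    show "inj_on w A"
    proof (rule inj_onI)
      fix d e assume de: "d \<in> A" "e \<in> A" "w d = w e"
      have "incidences G (w d) d > 0" "incidences G (w e) e > 0"
        by (auto simp: w_def incidences_def)
      then show "d = e" using unique[of "w e" d e] A[OF de(2)] de by (simp add: A_def)
    qed
    show "w ` A = leaves G"
    proof (intro equalityI subsetI)
      fix v assume v: "v \<in> leaves G"
      obtain e where e: "e \<in> edges G" "incidences G v e = 1" "other_end e v = u"
        using parent[OF v] by blast
      have "v \<noteq> u" using v by (simp add: leaves)
      then have "e \<in> A \<and> w e = v"
        using e incidences_eq_1(2)[OF e(2)] by (auto simp: A_def B_def w_def)
      then show "v \<in> w ` A" by blast
    qed (use A in blast)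
  qed
  moreover have "card A = card (leaves G)" using calculation by (rule bij_betw_same_card)
  moreover have "int (card B) = cyc G"
  proof -
    have "card (verts G) = card (leaves G) + 1"
      using card_Suc_Diff1[OF finite_verts u(1)] unfolding leaves by linarith
    moreover have "card (edges G) = card A + card B"
      using finite_edges card_Diff_subset[of B "edges G"] card_mono[of "edges G" B]
      by (auto simp: A_def B_def)
    ultimately show ?thesis using \<open>card A = card (leaves G)\<close> by (simp add: cyc_def)
  qed
  moreover have "verts G - leaves G = {u}" using u by (auto simp: leaves)
  moreover have "edges G = A \<union> B" "A \<inter> B = {}" by (auto simp: A_def B_def)
  moreover have "\<forall>e\<in>B. tail G e = u \<and> head G e = u \<and> elen G e = 2 * R"
    using loop by (auto simp: B_def)
  moreover have "\<forall>e\<in>A. {tail G e, head G e} = {u, w e} \<and> elen G e = R" using A by blast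
  ultimately show ?thesis
    unfolding star_with_loops_def
    by (intro exI[of _ u] exI[of _ A] exI[of _ B] exI[of _ w] conjI) assumption+
qed

lemma star_with_loops_total_length:
  assumes "star_with_loops G n c R"
  shows "total_length G = of_int (2 * c + int n) * R"
proof -
  obtain u A B w where AB: "edges G = A \<union> B" "A \<inter> B = {}" "card A = n" "int (card B) = c"
    "\<forall>e\<in>A. {tail G e, head G e} = {u, w e} \<and> elen G e = R"
    "\<forall>e\<in>B. tail G e = u \<and> head G e = u \<and> elen G e = 2 * R"
    using assms unfolding star_with_loops_def by blast
  have "total_length G = (\<Sum>e\<in>A. elen G e) + (\<Sum>e\<in>B. elen G e)"
    unfolding total_length_def AB(1) using AB(1,2) finite_edges by (intro sum.union_disjoint) auto
  also have "\<dots> = real n * R + real (card B) * (2 * R)" using AB by simp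
  finally show ?thesis using AB(4) by (simp flip: AB(4) add: algebra_simps)
qed

end

section \<open>Descriptions with the centre as a vertex\<close>

text \<open>The leaf count and the cyclomatic number are carried along with the isometry, so their
  invariance is checked only for relabelling, subdividing and merging.\<close>

definition pointed_model ::
  "('v, 'e) wgraph \<Rightarrow> ('v, 'e) point \<Rightarrow> ('w, 'f) wgraph \<Rightarrow> 'w \<Rightarrow> bool" where
  "pointed_model G c H u \<longleftrightarrow> connected_wgraph H \<and> u \<in> verts H \<and>
     (\<exists>g. graph_isometry G H g \<and> g c = Vertex u) \<and>
     card (leaves H) = card (leaves G) \<and> cyc H = cyc G"

text \<open>Renaming by natural numbers leaves fresh names available; if \<open>c\<close> is then an
  inner point, the edge is subdivided there.\<close>

lemma pointed_model_exists:
  fixes G :: "('v, 'e) wgraph"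
  assumes G: "connected_wgraph G" and c: "c \<in> points G"
  shows "\<exists>(H :: (nat, nat) wgraph) u. pointed_model G c H u"
proof -
  interpret G: connected_wgraph G by fact
  obtain \<alpha> :: "'v \<Rightarrow> nat" where \<alpha>: "inj_on \<alpha> (verts G)"
    using finite_imp_inj_to_nat_seg[OF G.finite_verts] by blast
  obtain \<beta> :: "'e \<Rightarrow> nat" where \<beta>: "inj_on \<beta> (edges G)"
    using finite_imp_inj_to_nat_seg[OF G.finite_edges] by blast
  define \<beta>' where "\<beta>' = inv_into (edges G) \<beta>"
  have \<beta>': "\<beta>' (\<beta> e) = e" if "e \<in> edges G" for e using \<beta> that by (simp add: \<beta>'_def)
  define H where "H = \<lparr>verts = \<alpha> ` verts G, edges = \<beta> ` edges G, tail = \<alpha> \<circ> tail G \<circ> \<beta>',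
    head = \<alpha> \<circ> head G \<circ> \<beta>', elen = elen G \<circ> \<beta>'\<rparr>"
  have rel: "connected_wgraph H" "card (leaves H) = card (leaves G)" "cyc H = cyc G"
    "\<exists>g. graph_isometry G H g \<and> (\<forall>v\<in>verts G. g (Vertex v) = Vertex (\<alpha> v))"
    by (rule relabel[OF G, of \<alpha> H \<beta>]; use \<alpha> \<beta> in \<open>simp add: H_def \<beta>' bij_betw_def\<close>)+
  interpret H: connected_wgraph H by (rule rel)
  obtain g where g: "graph_isometry G H g" using rel(4) by blast
  then have "g c \<in> points H" using c by (auto simp: graph_isometry_def bij_betw_apply)
  then show ?thesis
  proof (cases rule: H.points_cases)
    case (1 u)
    then show ?thesis using rel g unfolding pointed_model_def by blast
  next
    case (2 e t)
    obtain w where w: "w \<notin> verts H" using ex_new_if_finite[OF _ H.finite_verts] by blast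
    obtain e' where e': "e' \<notin> edges H" using ex_new_if_finite[OF _ H.finite_edges] by blast
    interpret K: subdivision H e t w e' by unfold_locales (use 2 w e' in auto)
    obtain h where h: "graph_isometry H (subdivide H e t w e') h" "h (Inner e t) = Vertex w"
      using K.subdivide_isometry by blast
    have "graph_isometry G (subdivide H e t w e') (h \<circ> g)" "(h \<circ> g) c = Vertex w"
      using graph_isometry_comp[OF g h(1)] h(2) 2 by simp_all
    then have "pointed_model G c (subdivide H e t w e') w"
      unfolding pointed_model_def
      using K.connected_subdivide rel K.subdivide_leaves K.subdivide_cyc K.subdivide_simps(1) by auto
    then show ?thesis by blast
  qed
qed

text \<open>A degree 2 vertex other than the centre could be merged away, contradicting the minimality
  of the number of edges; the extremal constraints leave only leaves and loops.\<close>

lemma minimal_model_star: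
  assumes G: "connected_wgraph G" and c: "c \<in> points G"
    and R: "\<And>y. y \<in> points G \<Longrightarrow> graph_dist G c y \<le> R"
    and len: "total_length G = of_int (2 * cyc G + int (card (leaves G))) * R"
    and H: "pointed_model G c (H :: ('w, 'f) wgraph) u"
    and min: "\<And>(K :: ('w, 'f) wgraph) v. pointed_model G c K v \<Longrightarrow> card (edges H) \<le> card (edges K)"
  shows "star_with_loops H (card (leaves G)) (cyc G) R"
proof -
  obtain g where g: "graph_isometry G H g" "g c = Vertex u" and u: "u \<in> verts H"
    and inv: "card (leaves H) = card (leaves G)" "cyc H = cyc G" and "connected_wgraph H"
    using H unfolding pointed_model_def by blast
  interpret H: connected_wgraph H by fact
  have R_H: "graph_dist H (Vertex u) y \<le> R" if y: "y \<in> points H" for y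
  proof -
    obtain x where "x \<in> points G" "y = g x"
      using g(1) y unfolding graph_isometry_def bij_betw_def by blast
    then show ?thesis using R[of x] g c by (metis graph_isometry_def)
  qed
  have "total_length H = of_int (2 * cyc H + int (card (leaves H))) * R"
    using graph_isometry_total_length[OF G H.connected_wgraph_axioms g(1)] len inv by simp
  note extremal = H.extremal_constraints[OF u R_H this]
  have deg2: "degree H v \<noteq> 2" if v: "v \<in> verts H" "v \<noteq> u" for v
  proof
    assume deg: "degree H v = 2"
    \<comment> \<open>The parent edge of \<open>v\<close> is not a loop, as \<open>merge\<close>
      requires. Since \<open>v \<noteq> u\<close>, the centre survives the merge.\<close>
    obtain e where e: "e \<in> edges H" "incidences H v e = 1"
      using H.parent_edge_exists[OF u v] by blast
    obtain K :: "('w, 'f) wgraph" and h where K: "connected_wgraph K" "graph_isometry H K h"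
      "\<forall>x\<in>verts H - {v}. x \<in> verts K \<and> h (Vertex x) = Vertex x"
      "card (leaves K) = card (leaves H)" "cyc K = cyc H" "card (edges K) < card (edges H)"
      by (rule merge[OF H.connected_wgraph_axioms e(1) v(1) deg e(2)])
    have "graph_isometry G K (h \<circ> g)" "(h \<circ> g) c = Vertex u" "u \<in> verts K"
      using graph_isometry_comp[OF g(1) K(2)] g(2) K(3) u v by auto
    then have "pointed_model G c K u"
      unfolding pointed_model_def using K(1,4,5) inv by auto
    then show False using min[of K u] K(6) by simp
  qed
  have "star_with_loops H (card (leaves H)) (cyc H) R"
    by (rule H.star_with_loopsI[OF u extremal(1)]) (use extremal deg2 in auto)
  then show ?thesis by (simp add: inv)
qed

section \<open>The equivalence for metric graphs\<close>

theorem mainTheorem2: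
  fixes X :: "'a metric" and G :: "('v, 'e) wgraph"
  assumes "describes G X"
  shows "total_length G = of_int (2 * cyc G + int (card (leaves G))) * radius X \<longleftrightarrow>
    (\<exists>H :: (nat, nat) wgraph. describes H X \<and>
       star_with_loops H (card (leaves G)) (cyc G) (radius X))"
proof
  have G: "connected_wgraph G" using assms by (simp add: describes_def)
  interpret G: connected_wgraph G by (rule G)
  obtain f where f: "bij_betw f (points G) (mspace X)"
    "\<And>x y. \<lbrakk>x \<in> points G; y \<in> points G\<rbrakk> \<Longrightarrow> mdist X (f x) (f y) = graph_dist G x y"
    using assms
    by (auto simp: describes_def isometric_spaces_def G.mspace_realization G.mdist_realization)
  {
    \<comment> \<open>The radius is carried over to \<open>G\<close> along \<open>f\<close>, where a
      centre attains it.\<close>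
    have "radius X = (INF x\<in>points G. SUP y\<in>points G. mdist X (f x) (f y))"
      using f(1) by (simp add: radius_def bij_betw_def image_image flip: bij_betw_imp_surj_on[OF f(1)])
    also have "\<dots> = (INF x\<in>points G. SUP y\<in>points G. graph_dist G x y)"
      by (intro INF_cong SUP_cong refl f(2))
    finally obtain c where c: "c \<in> points G" "\<And>y. y \<in> points G \<Longrightarrow> graph_dist G c y \<le> radius X"
      using G.center_exists by auto
    assume len: "total_length G = of_int (2 * cyc G + int (card (leaves G))) * radius X"
    have "\<exists>H :: (nat, nat) wgraph. \<exists>u. pointed_model G c H u"
      using pointed_model_exists[OF G c(1)] .
    \<comment> \<open>The number of edges is minimised over all models, whatever vertex represents
      the centre in them.\<close>
    then obtain H :: "(nat, nat) wgraph" where H: "\<exists>u. pointed_model G c H u"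
      and min: "\<And>K :: (nat, nat) wgraph. \<exists>v. pointed_model G c K v \<Longrightarrow> card (edges H) \<le> card (edges K)"
      using ex_has_least_nat[of "\<lambda>H :: (nat, nat) wgraph. \<exists>u. pointed_model G c H u" _
          "\<lambda>H. card (edges H)"] by blast
    obtain u where u: "pointed_model G c H u" using H by blast
    have "star_with_loops H (card (leaves G)) (cyc G) (radius X)"
    proof (rule minimal_model_star[OF G c len u])
      fix K :: "(nat, nat) wgraph" and v assume "pointed_model G c K v"
      then show "card (edges H) \<le> card (edges K)" by (intro min exI)
    qed
    moreover have "describes H X"
    proof -
      obtain g where g: "graph_isometry G H g" and "connected_wgraph H"
        using u unfolding pointed_model_def by blast
      interpret H: connected_wgraph H by fact
      define h where "h = inv_into (points G) g"
      have h: "graph_isometry H G h" using graph_isometry_inv[OF g] by (simp add: h_def)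
      have "bij_betw (f \<circ> h) (points H) (mspace X)"
        using h f(1) unfolding graph_isometry_def by (blast intro: bij_betw_trans)
      moreover have "mdist X ((f \<circ> h) x) ((f \<circ> h) y) = graph_dist H x y"
        if "x \<in> points H" "y \<in> points H" for x y
        using h f(2) that by (auto simp: graph_isometry_def bij_betw_apply)
      ultimately show ?thesis
        unfolding describes_def isometric_spaces_def H.mspace_realization H.mdist_realization
        using H.connected_wgraph_axioms by blast
    qed
    ultimately show "\<exists>H :: (nat, nat) wgraph. describes H X \<and>
       star_with_loops H (card (leaves G)) (cyc G) (radius X)" by blast
  }
  assume "\<exists>H :: (nat, nat) wgraph. describes H X \<and>
       star_with_loops H (card (leaves G)) (cyc G) (radius X)"
  then obtain H :: "(nat, nat) wgraph" where H: "connected_wgraph H"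
    and iso: "isometric_spaces (realization H) X"
    and star: "star_with_loops H (card (leaves G)) (cyc G) (radius X)"
    unfolding describes_def by blast
  interpret H: connected_wgraph H by (rule H)
  obtain h where h: "bij_betw h (points H) (mspace X)"
    "\<And>x y. \<lbrakk>x \<in> points H; y \<in> points H\<rbrakk> \<Longrightarrow> mdist X (h x) (h y) = graph_dist H x y"
    using iso by (auto simp: isometric_spaces_def H.mspace_realization H.mdist_realization)
  define k where "k = inv_into (points H) h"
  have k: "bij_betw k (mspace X) (points H)"
    unfolding k_def by (rule bij_betw_inv_into[OF h(1)])
  \<comment> \<open>\<open>G\<close> and \<open>H\<close> are compared through \<open>X\<close>. As
    \<open>star\<close> speaks of the invariants of \<open>G\<close>, the equality of the two total
    lengths is already the required formula.\<close>
  have "graph_isometry G H (k \<circ> f)"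
    unfolding graph_isometry_def
  proof (intro conjI ballI)
    show "bij_betw (k \<circ> f) (points G) (points H)" by (rule bij_betw_trans[OF f(1) k])
    have hk: "h (k z) = z" if "z \<in> mspace X" for z
      using bij_betw_inv_into_right[OF h(1) that] by (simp add: k_def)
    fix x y assume xy: "x \<in> points G" "y \<in> points G"
    then have "f x \<in> mspace X" "f y \<in> mspace X" using bij_betw_apply[OF f(1)] by auto
    then show "graph_dist H ((k \<circ> f) x) ((k \<circ> f) y) = graph_dist G x y"
      using h(2)[of "k (f x)" "k (f y)"] f(2)[OF xy] bij_betw_apply[OF k] by (simp add: hk)
  qed
  then show "total_length G = of_int (2 * cyc G + int (card (leaves G))) * radius X"
    using graph_isometry_total_length[OF G H] H.star_with_loops_total_length[OF star] by simp
qed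

end
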